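(* Let $M\subseteq\mathbb{D}^d$ be a constructible set, and let $(X,d)$ be either $(\mathbb{I},d_2)$ or $(\Theta,d_g)$. Let $A\subseteq\mathbb{S}^{d-1}$ be an $\epsilon_A$-net of $(\mathbb{S}^{d-1},d)$ and let $\mathbb{T}\subseteq X$ be an $\epsilon_{\mathbb{T}}$-net of $X$. Then for every degree $n$ the PHT interleaving distance between $\mathrm{PHT}^X_n(M)$ and its Kan extension (left, right, or center) $\overline{\mathrm{PHT}}^X_n(M)$ from the discrete data on $\mathbb{AT}$ satisfies $$d_I\bigl(\mathrm{PHT}^X_n(M),\overline{\mathrm{PHT}}^X_n(M)\bigr)\le 2\epsilon_A+\epsilon_{\mathbb{T}}.$$
   Context: Fix a field $\Bbbk$; $\mathrm{Vect}$ is the category of $\Bbbk$-vector spaces and $H_n$ is homology with coefficients in $\Bbbk$. Fix an o-minimal structure $\mathcal{O}=\{\mathcal{O}_d\}$: for each $d\ge 0$ a boolean algebra $\mathcal{O}_d$ of subsets of $\mathbb{R}^d$, with $\mathcal{O}_1$ consisting only of finite unions of points and intervals, closed under $A\mapsto A\times\mathbb{R},\ \mathbb{R}\times A$ and under axis-aligned projections $\mathbb{R}^{d+1}\to\mathbb{R}^d$, and containing all semialgebraic sets. A constructible set is a compact member of some $\mathcal{O}_d$. $\mathbb{D}^d$ is the closed unit ball in $\mathbb{R}^d$, $\mathbb{S}^{d-1}$ the unit sphere. For $v\in\mathbb{S}^{d-1}$, $t\in\mathbb{R}$, put $M_{v,t}=\{x\in M: x\cdot v\le t\}$. $\mathbb{I}=[-1,1]$,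 $\Theta=[-\pi,0]$; $d_2(v,w)=\|v-w\|_2$ and $d_g(v,w)=\arccos(v\cdot w)$ on $\mathbb{S}^{d-1}$. $A$ is an $\epsilon_A$-net if every $w\in\mathbb{S}^{d-1}$ has some $v\in A$ with $d(v,w)\le\epsilon_A$. $\mathbb{T}\subseteq X$ is an $\epsilon_{\mathbb{T}}$-net of $X$ if for every $y\in X$ there is $t'\in\mathbb{T}$ with $t'\in[y,y+\epsilon_{\mathbb{T}}]$. The interval $X$ is viewed as a category via $\le$, and $\mathrm{Vect}^X$ is the category of functors $X\to\mathrm{Vect}$ ($X$-persistence modules). The persistent homology transform $\mathrm{PHT}^X_n(M):\mathbb{S}^{d-1}\to\mathrm{Vect}^X$ is given by $\mathrm{PHT}^{\mathbb{I}}_n(M)(v)(t)=H_n(M_{v,t})$ and $\mathrm{PHT}^{\Theta}_n(M)(v)(\theta)=H_n(M_{v,\cos\theta})$, with maps induced by inclusions. Interleaving distance: for $\varepsilon\ge0$ let $T_\varepsilon:X\to X$, $T_\varepsilon(x)=\min(x+\varepsilon,\sup X)$. An $\varepsilon$-interleaving between $U,V\in\mathrm{Vect}^X$ is a pair of natural transformations $\Phi:U\Rightarrow VT_\varepsilon$, $\Psi:V\Rightarrow UT_\varepsilon$ with $(\Psi T_\varepsilon)\Phi=U\sigma_{2\varepsilon}$ and $(\Phi T_\varepsilon)\Psi=V\sigma_{2\varepsilon}$, where $\sigma_{2\varepsilon}:\mathrm{Id}\Rightarrow T_{2\varepsilon}$ is the canonical natural transformation. $d_{\mathrm{Int}}(U,V)$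 is the infimum of the $\varepsilon\ge0$ for which an $\varepsilon$-interleaving exists ($\infty$ if none). For maps $F,F':\mathbb{S}^{d-1}\to\mathrm{Vect}^X$, the PHT interleaving distance is $d_I(F,F')=\sup_{v\in\mathbb{S}^{d-1}}d_{\mathrm{Int}}(F(v),F'(v))$. Space-time categories: $\mathbb{S}^{d-1}\mathbb{X}$ is the pre-order category with object set $\mathbb{S}^{d-1}\times X$ and a unique morphism $(v,\alpha)\to(w,\beta)$ exactly when $\alpha+d(v,w)\le\beta$ or $\beta=\sup X$. $\mathbb{AT}$ is its full subcategory on the objects $A\times\mathbb{T}$. Whenever a morphism $(v,\alpha)\to(w,\beta)$ exists, the sublevel set of $M$ at $(v,\alpha)$ is contained in that at $(w,\beta)$, so $G(v,\alpha)=\mathrm{PHT}^X_n(M)(v)(\alpha)$ with inclusion-induced maps is a functor $G:\mathbb{AT}\to\mathrm{Vect}$. Kan extensions along $\mathbb{AT}\hookrightarrow\mathbb{S}^{d-1}\mathbb{X}$: for $(w,\beta)\in\mathbb{S}^{d-1}\mathbb{X}$, the left Kan extension is $\mathrm{Lan}(w,\beta)=\operatorname{colim} G(v,\alpha)$ over the full subcategory of $(v,\alpha)\in\mathbb{AT}$ admitting a morphism $(v,\alpha)\to(w,\beta)$; the right Kan extension is $\mathrm{Ran}(w,\beta)=\lim G(v,\alpha)$ over the full subcategory of $(v,\alpha)\in\mathbb{AT}$ admitting a morphism $(w,\beta)\to(v,\alpha)$; the center Kan extension assigns to $(w,\beta)$ the image of the canonical map $\mathrm{Lan}(w,\beta)\to\mathrm{Ran}(w,\beta)$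 (induced by the universal properties from the maps of $G$ on composites $(v,\alpha)\to(w,\beta)\to(v',\alpha')$). For any one of these choices $\hat G$, $\overline{\mathrm{PHT}}^X_n(M)(w)=\hat G(w,\cdot)$. *)

theory Defs
  imports "HOL-Analysis.Analysis" "HOL-Homology.Homology"
begin

section \<open>O-minimal structures\<close>

text \<open>
  \<open>\<real>\<^sup>d\<close> is \<^term>\<open>topspace (Euclidean_space d)\<close>: the sequences of reals that vanish from index
  \<open>d\<close> on. In this way all dimensions live in one type and \<open>d\<close> is an ordinary variable.
\<close>

abbreviation R_pow :: "nat \<Rightarrow> (nat \<Rightarrow> real) set"
  where "R_pow d \<equiv> topspace (Euclidean_space d)"

inductive_set polynomial_fun :: "nat \<Rightarrow> ((nat \<Rightarrow> real) \<Rightarrow> real) set" for d :: nat where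
  const: "(\<lambda>x. c) \<in> polynomial_fun d"
| coord: "i < d \<Longrightarrow> (\<lambda>x. x i) \<in> polynomial_fun d"
| add: "p \<in> polynomial_fun d \<Longrightarrow> q \<in> polynomial_fun d \<Longrightarrow> (\<lambda>x. p x + q x) \<in> polynomial_fun d"
| mult: "p \<in> polynomial_fun d \<Longrightarrow> q \<in> polynomial_fun d \<Longrightarrow> (\<lambda>x. p x * q x) \<in> polynomial_fun d"

inductive_set semialgebraic :: "nat \<Rightarrow> (nat \<Rightarrow> real) set set" for d :: nat where
  eq: "p \<in> polynomial_fun d \<Longrightarrow> {x \<in> R_pow d. p x = 0} \<in> semialgebraic d"
| pos: "p \<in> polynomial_fun d \<Longrightarrow> {x \<in> R_pow d. p x > 0} \<in> semialgebraic d"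
| compl: "S \<in> semialgebraic d \<Longrightarrow> R_pow d - S \<in> semialgebraic d"
| union: "S \<in> semialgebraic d \<Longrightarrow> S' \<in> semialgebraic d \<Longrightarrow> S \<union> S' \<in> semialgebraic d"

definition drop_coord :: "nat \<Rightarrow> (nat \<Rightarrow> real) \<Rightarrow> nat \<Rightarrow> real"
  where "drop_coord j x = (\<lambda>i. if i < j then x i else x (Suc i))"

text \<open>
  On \<open>\<real>\<^sup>d\<^sup>+\<^sup>1\<close>, \<^term>\<open>drop_coord d\<close> forgets the last coordinate and \<^term>\<open>drop_coord 0\<close> the first, so
  the preimages below are \<open>S \<times> \<real>\<close> and \<open>\<real> \<times> S\<close>. Points count as (degenerate) intervals.
\<close>

definition o_minimal :: "(nat \<Rightarrow> (nat \<Rightarrow> real) set set) \<Rightarrow> bool" where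
  "o_minimal Om \<longleftrightarrow>
     (\<forall>d. Sigma_Algebra.algebra (R_pow d) (Om d)) \<and>
     (\<forall>S \<in> Om 1. \<exists>F. finite F \<and> (\<forall>I\<in>F. is_interval I) \<and> (\<lambda>x. x 0) ` S = \<Union>F) \<and>
     (\<forall>d. \<forall>S \<in> Om d. {x \<in> R_pow (Suc d). drop_coord d x \<in> S} \<in> Om (Suc d)) \<and>
     (\<forall>d. \<forall>S \<in> Om d. {x \<in> R_pow (Suc d). drop_coord 0 x \<in> S} \<in> Om (Suc d)) \<and>
     (\<forall>d. \<forall>S \<in> Om (Suc d). \<forall>j\<le>d. drop_coord j ` S \<in> Om d) \<and>
     (\<forall>d. semialgebraic d \<subseteq> Om d)"

definition constructible :: "(nat \<Rightarrow> (nat \<Rightarrow> real) set set) \<Rightarrow> nat \<Rightarrow> (nat \<Rightarrow> real) set \<Rightarrow> bool"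
  where "constructible Om d M \<longleftrightarrow> M \<in> Om d \<and> compactin (Euclidean_space d) M"


section \<open>Vector spaces\<close>

text \<open>
  A vector space over \<^typ>\<open>'k::field\<close> is a \<^locale>\<open>module\<close> over the ring \<open>scalars\<close>. The record type
  of modules extends that of rings; its fields \<^const>\<open>mult\<close> and \<^const>\<open>one\<close> have no meaning for
  modules and are left undefined.
\<close>

definition scalars :: "'k::field ring"
  where "scalars = \<lparr>carrier = UNIV, mult = (*), one = 1, zero = 0, add = (+)\<rparr>"

definition linear_maps :: "('k::field, 'a) module \<Rightarrow> ('k, 'b) module \<Rightarrow> ('a \<Rightarrow> 'b) set" where
  "linear_maps U V = {f \<in> carrier U \<rightarrow> carrier V.
     (\<forall>x \<in> carrier U. \<forall>y \<in> carrier U. f (x \<oplus>\<^bsub>U\<^esub> y) = f x \<oplus>\<^bsub>V\<^esub> f y) \<and>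
     (\<forall>a. \<forall>x \<in> carrier U. f (a \<odot>\<^bsub>U\<^esub> x) = a \<odot>\<^bsub>V\<^esub> f x)}"

text \<open>
  In the scalar multiplication of cosets, \<open>W\<close> is added because for \<open>a = 0\<close> the pointwise product
  \<open>a C\<close> is only \<open>{0}\<close>.
\<close>

definition quotient_space :: "('k::field, 'a) module \<Rightarrow> 'a set \<Rightarrow> ('k, 'a set) module" where
  "quotient_space V W =
     \<lparr>carrier = a_rcosets\<^bsub>V\<^esub> W, mult = undefined, one = undefined, zero = W, add = set_add V,
      smult = (\<lambda>a C. W <+>\<^bsub>V\<^esub> (\<lambda>x. a \<odot>\<^bsub>V\<^esub> x) ` C)\<rparr>"

definition span_in :: "('k::field, 'a) module \<Rightarrow> 'a set \<Rightarrow> 'a set"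
  where "span_in V S = \<Inter>{W. submodule W scalars V \<and> S \<subseteq> W}"

definition direct_product :: "'i set \<Rightarrow> ('i \<Rightarrow> ('k::field, 'a) module) \<Rightarrow> ('k, 'i \<Rightarrow> 'a) module" where
  "direct_product J V =
     \<lparr>carrier = (\<Pi>\<^sub>E j\<in>J. carrier (V j)), mult = undefined, one = undefined,
      zero = (\<lambda>j\<in>J. \<zero>\<^bsub>V j\<^esub>), add = (\<lambda>f g. \<lambda>j\<in>J. f j \<oplus>\<^bsub>V j\<^esub> g j),
      smult = (\<lambda>a f. \<lambda>j\<in>J. a \<odot>\<^bsub>V j\<^esub> f j)\<rparr>"

definition direct_sum :: "'i set \<Rightarrow> ('i \<Rightarrow> ('k::field, 'a) module) \<Rightarrow> ('k, 'i \<Rightarrow> 'a) module" where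
  "direct_sum J V = (direct_product J V)
     \<lparr>carrier := {f \<in> carrier (direct_product J V). finite {j\<in>J. f j \<noteq> \<zero>\<^bsub>V j\<^esub>}}\<rparr>"

definition direct_sum_inj ::
    "'i set \<Rightarrow> ('i \<Rightarrow> ('k::field, 'a) module) \<Rightarrow> 'i \<Rightarrow> 'a \<Rightarrow> 'i \<Rightarrow> 'a"
  where "direct_sum_inj J V i x = (\<lambda>j\<in>J. if j = i then x else \<zero>\<^bsub>V j\<^esub>)"


section \<open>Diagrams of vector spaces, colimits and limits\<close>

text \<open>
  Data of a functor to vector spaces from a pre-order \<open>(P, R)\<close>: \<open>ar D i j\<close> is the value on
  the unique morphism \<open>i \<rightarrow> j\<close> and is meaningful only for \<open>i, j \<in> P\<close> with \<open>R i j\<close>.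
\<close>

record ('i, 'k, 'a) diagram =
  ob :: "'i \<Rightarrow> ('k, 'a) module"
  ar :: "'i \<Rightarrow> 'i \<Rightarrow> 'a \<Rightarrow> 'a"

text \<open>
  Colimit over the full subcategory on \<open>J\<close>: the direct sum modulo the identifications of \<open>x\<close>
  at \<open>i\<close> with its image at \<open>j\<close>.
\<close>

definition colimit_relations ::
    "('i \<Rightarrow> 'i \<Rightarrow> bool) \<Rightarrow> 'i set \<Rightarrow> ('i, 'k::field, 'a) diagram \<Rightarrow> ('i \<Rightarrow> 'a) set" where
  "colimit_relations R J D = span_in (direct_sum J (ob D))
     {direct_sum_inj J (ob D) i x \<ominus>\<^bsub>direct_sum J (ob D)\<^esub> direct_sum_inj J (ob D) j (ar D i j x)
       | i j x. i \<in> J \<and> j \<in> J \<and> R i j \<and> x \<in> carrier (ob D i)}"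

definition colimit ::
    "('i \<Rightarrow> 'i \<Rightarrow> bool) \<Rightarrow> 'i set \<Rightarrow> ('i, 'k::field, 'a) diagram \<Rightarrow> ('k, ('i \<Rightarrow> 'a) set) module"
  where "colimit R J D = quotient_space (direct_sum J (ob D)) (colimit_relations R J D)"

definition limit ::
    "('i \<Rightarrow> 'i \<Rightarrow> bool) \<Rightarrow> 'i set \<Rightarrow> ('i, 'k::field, 'a) diagram \<Rightarrow> ('k, 'i \<Rightarrow> 'a) module" where
  "limit R J D = (direct_product J (ob D))
     \<lparr>carrier := {f \<in> carrier (direct_product J (ob D)).
                    \<forall>i\<in>J. \<forall>j\<in>J. R i j \<longrightarrow> ar D i j (f i) = f j}\<rparr>"


section \<open>Kan extensions along full inclusions of pre-orders\<close>

text \<open>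
  \<open>J\<close> is a subset of a pre-order with relation \<open>R\<close> and \<open>D\<close> a diagram on \<open>J\<close>.
\<close>

definition below :: "('i \<Rightarrow> 'i \<Rightarrow> bool) \<Rightarrow> 'i set \<Rightarrow> 'i \<Rightarrow> 'i set"
  where "below R J p = {j \<in> J. R j p}"

definition above :: "('i \<Rightarrow> 'i \<Rightarrow> bool) \<Rightarrow> 'i set \<Rightarrow> 'i \<Rightarrow> 'i set"
  where "above R J p = {j \<in> J. R p j}"

text \<open>
  If \<open>R p q\<close>, then \<open>below R J p \<subseteq> below R J q\<close>; the induced map of colimits comes from
  extending the elements of the direct sum by zero. Dually, for limits it restricts families to
  \<open>above R J q \<subseteq> above R J p\<close>.
\<close>

definition left_kan ::
    "('i \<Rightarrow> 'i \<Rightarrow> bool) \<Rightarrow> 'i set \<Rightarrow> ('i, 'k::field, 'a) diagram \<Rightarrow> ('i, 'k, ('i \<Rightarrow> 'a) set) diagram" where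
  "left_kan R J D =
     \<lparr>ob = (\<lambda>p. colimit R (below R J p) D),
      ar = (\<lambda>p q C. colimit_relations R (below R J q) D <+>\<^bsub>direct_sum (below R J q) (ob D)\<^esub>
              (\<lambda>f. \<lambda>j\<in>below R J q. if j \<in> below R J p then f j else \<zero>\<^bsub>ob D j\<^esub>) ` C)\<rparr>"

definition right_kan ::
    "('i \<Rightarrow> 'i \<Rightarrow> bool) \<Rightarrow> 'i set \<Rightarrow> ('i, 'k::field, 'a) diagram \<Rightarrow> ('i, 'k, 'i \<Rightarrow> 'a) diagram" where
  "right_kan R J D =
     \<lparr>ob = (\<lambda>p. limit R (above R J p) D),
      ar = (\<lambda>p q f. restrict f (above R J q))\<rparr>"

text \<open>
  The canonical map sends the class of a finitely supported family \<open>f\<close> below \<open>p\<close> to the family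
  above \<open>p\<close> with component \<open>\<Sum>\<^sub>j D(j \<rightarrow> l) (f j)\<close> at \<open>l\<close>; this is constant on each class.
\<close>

definition left_to_right ::
    "('i \<Rightarrow> 'i \<Rightarrow> bool) \<Rightarrow> 'i set \<Rightarrow> ('i, 'k::field, 'a) diagram \<Rightarrow> 'i \<Rightarrow> ('i \<Rightarrow> 'a) set \<Rightarrow> 'i \<Rightarrow> 'a" where
  "left_to_right R J D p C = the_elem
     ((\<lambda>f. \<lambda>l\<in>above R J p.
         \<Oplus>\<^bsub>ob D l\<^esub>j\<in>{j \<in> below R J p. f j \<noteq> \<zero>\<^bsub>ob D j\<^esub>}. ar D j l (f j)) ` C)"

definition center_kan ::
    "('i \<Rightarrow> 'i \<Rightarrow> bool) \<Rightarrow> 'i set \<Rightarrow> ('i, 'k::field, 'a) diagram \<Rightarrow> ('i, 'k, 'i \<Rightarrow> 'a) diagram" where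
  "center_kan R J D =
     \<lparr>ob = (\<lambda>p. (ob (right_kan R J D) p)
              \<lparr>carrier := left_to_right R J D p ` carrier (ob (left_kan R J D) p)\<rparr>),
      ar = ar (right_kan R J D)\<rparr>"


section \<open>Interleaving distance\<close>

definition shift :: "real set \<Rightarrow> real \<Rightarrow> real \<Rightarrow> real"
  where "shift X e x = min (x + e) (Sup X)"

definition precomp :: "(real, 'k, 'a) diagram \<Rightarrow> (real \<Rightarrow> real) \<Rightarrow> (real, 'k, 'a) diagram"
  where "precomp U \<tau> = \<lparr>ob = (\<lambda>x. ob U (\<tau> x)), ar = (\<lambda>x y. ar U (\<tau> x) (\<tau> y))\<rparr>"

definition nat_trans ::
    "real set \<Rightarrow> (real, 'k::field, 'a) diagram \<Rightarrow> (real, 'k, 'b) diagram \<Rightarrow> (real \<Rightarrow> 'a \<Rightarrow> 'b) set" where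
  "nat_trans X U V = {\<Phi>.
     (\<forall>x\<in>X. \<Phi> x \<in> linear_maps (ob U x) (ob V x)) \<and>
     (\<forall>x\<in>X. \<forall>y\<in>X. x \<le> y \<longrightarrow>
        (\<forall>u\<in>carrier (ob U x). \<Phi> y (ar U x y u) = ar V x y (\<Phi> x u)))}"

definition interleaved ::
    "real set \<Rightarrow> real \<Rightarrow> (real, 'k::field, 'a) diagram \<Rightarrow> (real, 'k, 'b) diagram \<Rightarrow> bool" where
  "interleaved X e U V \<longleftrightarrow>
     (\<exists>\<Phi> \<in> nat_trans X U (precomp V (shift X e)). \<exists>\<Psi> \<in> nat_trans X V (precomp U (shift X e)).
        (\<forall>x\<in>X. \<forall>u\<in>carrier (ob U x). \<Psi> (shift X e x) (\<Phi> x u) = ar U x (shift X (2 * e) x) u) \<and>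
        (\<forall>x\<in>X. \<forall>v\<in>carrier (ob V x). \<Phi> (shift X e x) (\<Psi> x v) = ar V x (shift X (2 * e) x) v))"

definition interleaving_dist ::
    "real set \<Rightarrow> (real, 'k::field, 'a) diagram \<Rightarrow> (real, 'k, 'b) diagram \<Rightarrow> ennreal"
  where "interleaving_dist X U V = (INF e\<in>{e. 0 \<le> e \<and> interleaved X e U V}. ennreal e)"


section \<open>Singular homology with coefficients in a field\<close>

text \<open>
  This follows \<^theory>\<open>HOL-Homology.Simplices\<close>, where the coefficients are integers. The type
  \<^typ>\<open>'k\<close> of coefficients is not determined by the topological data, hence the argument of
  type \<^typ>\<open>'k itself\<close>.
\<close>

type_synonym ('k, 'x) kchain = "((nat \<Rightarrow> real) \<Rightarrow> 'x) \<Rightarrow>\<^sub>0 'k"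

definition chain_space :: "nat \<Rightarrow> 'x topology \<Rightarrow> ('k::field, ('k, 'x) kchain) module" where
  "chain_space p X =
     \<lparr>carrier = {c. Poly_Mapping.keys c \<subseteq> singular_simplex_set p X},
      mult = undefined, one = undefined, zero = 0, add = (+),
      smult = (\<lambda>a. Poly_Mapping.map ((*) a))\<rparr>"

definition boundary_map :: "nat \<Rightarrow> ('k::field, 'x) kchain \<Rightarrow> ('k, 'x) kchain" where
  "boundary_map p c =
     (if p = 0 then 0
      else \<Sum>f\<in>Poly_Mapping.keys c. \<Sum>i\<le>p.
             Poly_Mapping.single (singular_face p i f) ((-1) ^ i * Poly_Mapping.lookup c f))"

definition cycles :: "nat \<Rightarrow> 'x topology \<Rightarrow> ('k::field, 'x) kchain set"
  where "cycles p X = {c \<in> carrier (chain_space p X). boundary_map p c = 0}"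

definition boundaries :: "nat \<Rightarrow> 'x topology \<Rightarrow> ('k::field, 'x) kchain set"
  where "boundaries p X = boundary_map (Suc p) ` carrier (chain_space (Suc p) X)"

definition homology ::
    "'k::field itself \<Rightarrow> nat \<Rightarrow> 'x topology \<Rightarrow> ('k, ('k, 'x) kchain set) module" where
  "homology k p X = quotient_space ((chain_space p X)\<lparr>carrier := cycles p X\<rparr>) (boundaries p X)"

text \<open>
  The map induced by the inclusion into \<open>Y\<close> of any of its subspaces: a simplex of the subspace
  is literally a simplex of \<open>Y\<close>, so \<open>c + B\<close> is sent to \<open>c + boundaries p Y\<close>.
\<close>

definition homology_incl ::
    "nat \<Rightarrow> 'x topology \<Rightarrow> ('k::field, 'x) kchain set \<Rightarrow> ('k, 'x) kchain set"
  where "homology_incl p Y C = boundaries p Y <+>\<^bsub>chain_space p Y\<^esub> C"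


section \<open>Persistent homology transforms\<close>

text \<open>
  \<open>Height\<close> stands for \<open>(\<I>, d\<^sub>2)\<close> with \<open>\<I> = [-1,1]\<close>, and \<open>Angle\<close> for \<open>(\<Theta>, d\<^sub>g)\<close> with
  \<open>\<Theta> = [-\<pi>,0]\<close>.
\<close>

datatype scale = Height | Angle

primrec param_set :: "scale \<Rightarrow> real set" where
  "param_set Height = {-1..1}"
| "param_set Angle = {-pi..0}"

primrec threshold :: "scale \<Rightarrow> real \<Rightarrow> real" where
  "threshold Height t = t"
| "threshold Angle t = cos t"

definition inner_prod :: "nat \<Rightarrow> (nat \<Rightarrow> real) \<Rightarrow> (nat \<Rightarrow> real) \<Rightarrow> real"
  where "inner_prod d x y = (\<Sum>i<d. x i * y i)"

text \<open>The unit sphere of \<open>\<real>\<^sup>d\<close>, of dimension \<open>d - 1\<close>.\<close>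

definition unit_sphere :: "nat \<Rightarrow> (nat \<Rightarrow> real) set"
  where "unit_sphere d = {v \<in> R_pow d. L2_set v {..<d} = 1}"

definition unit_ball :: "nat \<Rightarrow> (nat \<Rightarrow> real) set"
  where "unit_ball d = {x \<in> R_pow d. L2_set x {..<d} \<le> 1}"

primrec sphere_dist :: "scale \<Rightarrow> nat \<Rightarrow> (nat \<Rightarrow> real) \<Rightarrow> (nat \<Rightarrow> real) \<Rightarrow> real" where
  "sphere_dist Height d v w = L2_set (\<lambda>i. v i - w i) {..<d}"
| "sphere_dist Angle d v w = arccos (inner_prod d v w)"

definition sphere_net :: "scale \<Rightarrow> nat \<Rightarrow> real \<Rightarrow> (nat \<Rightarrow> real) set \<Rightarrow> bool" where
  "sphere_net s d \<epsilon> A \<longleftrightarrow>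
     A \<subseteq> unit_sphere d \<and> (\<forall>w\<in>unit_sphere d. \<exists>v\<in>A. sphere_dist s d v w \<le> \<epsilon>)"

definition interval_net :: "real set \<Rightarrow> real \<Rightarrow> real set \<Rightarrow> bool" where
  "interval_net X \<epsilon> T \<longleftrightarrow> T \<subseteq> X \<and> (\<forall>y\<in>X. \<exists>t\<in>T. t \<in> {y..y + \<epsilon>})"

definition sublevel ::
    "scale \<Rightarrow> nat \<Rightarrow> (nat \<Rightarrow> real) set \<Rightarrow> (nat \<Rightarrow> real) \<Rightarrow> real \<Rightarrow> (nat \<Rightarrow> real) topology" where
  "sublevel s d M v t =
     subtopology (Euclidean_space d) {x \<in> M. inner_prod d x v \<le> threshold s t}"

type_synonym 'k hclass = "('k, nat \<Rightarrow> real) kchain set"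

definition PHT ::
    "'k::field itself \<Rightarrow> scale \<Rightarrow> nat \<Rightarrow> nat \<Rightarrow> (nat \<Rightarrow> real) set \<Rightarrow>
     (nat \<Rightarrow> real) \<Rightarrow> (real, 'k, 'k hclass) diagram" where
  "PHT k s d n M v =
     \<lparr>ob = (\<lambda>t. homology k n (sublevel s d M v t)),
      ar = (\<lambda>t t'. homology_incl n (sublevel s d M v t'))\<rparr>"

definition PHT_dist ::
    "scale \<Rightarrow> nat \<Rightarrow> ((nat \<Rightarrow> real) \<Rightarrow> (real, 'k::field, 'a) diagram) \<Rightarrow>
     ((nat \<Rightarrow> real) \<Rightarrow> (real, 'k, 'b) diagram) \<Rightarrow> ennreal" where
  "PHT_dist s d F F' = (SUP v\<in>unit_sphere d. interleaving_dist (param_set s) (F v) (F' v))"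


section \<open>Space-time categories and the Kan extensions of the transform\<close>

type_synonym spacetime = "(nat \<Rightarrow> real) \<times> real"

fun spacetime_le :: "scale \<Rightarrow> nat \<Rightarrow> spacetime \<Rightarrow> spacetime \<Rightarrow> bool" where
  "spacetime_le s d (v, \<alpha>) (w, \<beta>) \<longleftrightarrow>
     \<alpha> + sphere_dist s d v w \<le> \<beta> \<or> \<beta> = Sup (param_set s)"

definition PHT_spacetime ::
    "'k::field itself \<Rightarrow> scale \<Rightarrow> nat \<Rightarrow> nat \<Rightarrow> (nat \<Rightarrow> real) set \<Rightarrow> (spacetime, 'k, 'k hclass) diagram"
  where
  "PHT_spacetime k s d n M =
     \<lparr>ob = (\<lambda>(v, \<alpha>). ob (PHT k s d n M v) \<alpha>),
      ar = (\<lambda>(v, \<alpha>) (w, \<beta>). homology_incl n (sublevel s d M w \<beta>))\<rparr>"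

definition slice :: "(spacetime, 'k, 'a) diagram \<Rightarrow> (nat \<Rightarrow> real) \<Rightarrow> (real, 'k, 'a) diagram" where
  "slice D w = \<lparr>ob = (\<lambda>\<beta>. ob D (w, \<beta>)), ar = (\<lambda>\<beta> \<beta>'. ar D (w, \<beta>) (w, \<beta>'))\<rparr>"

text \<open>\<open>A \<times> T\<close> is the set of objects of the discrete space-time category.\<close>

definition PHT_left ::
    "'k::field itself \<Rightarrow> scale \<Rightarrow> nat \<Rightarrow> nat \<Rightarrow> (nat \<Rightarrow> real) set \<Rightarrow> (nat \<Rightarrow> real) set \<Rightarrow> real set \<Rightarrow>
     (nat \<Rightarrow> real) \<Rightarrow> (real, 'k, (spacetime \<Rightarrow> 'k hclass) set) diagram" where
  "PHT_left k s d n M A T = slice (left_kan (spacetime_le s d) (A \<times> T) (PHT_spacetime k s d n M))"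

definition PHT_right ::
    "'k::field itself \<Rightarrow> scale \<Rightarrow> nat \<Rightarrow> nat \<Rightarrow> (nat \<Rightarrow> real) set \<Rightarrow> (nat \<Rightarrow> real) set \<Rightarrow> real set \<Rightarrow>
     (nat \<Rightarrow> real) \<Rightarrow> (real, 'k, spacetime \<Rightarrow> 'k hclass) diagram" where
  "PHT_right k s d n M A T = slice (right_kan (spacetime_le s d) (A \<times> T) (PHT_spacetime k s d n M))"

definition PHT_center ::
    "'k::field itself \<Rightarrow> scale \<Rightarrow> nat \<Rightarrow> nat \<Rightarrow> (nat \<Rightarrow> real) set \<Rightarrow> (nat \<Rightarrow> real) set \<Rightarrow> real set \<Rightarrow>
     (nat \<Rightarrow> real) \<Rightarrow> (real, 'k, spacetime \<Rightarrow> 'k hclass) diagram" where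
  "PHT_center k s d n M A T = slice (center_kan (spacetime_le s d) (A \<times> T) (PHT_spacetime k s d n M))"

end

theory Submission
  imports Defs
begin

text \<open>
  Let \<open>\<epsilon> = 2 \<epsilon>\<^sub>A + \<epsilon>\<^sub>T\<close> and write \<open>H(v, \<alpha>)\<close> for the homology of the sublevel set at \<open>(v, \<alpha>)\<close>. The
  transform and the discrete data are restrictions of one functor \<open>H\<close> on the whole space-time
  pre-order, so it suffices to compare, for a fixed direction \<open>w\<close>, the functor \<open>H\<close> along the line
  \<open>{w} \<times> X\<close> with the extension of its restriction to \<open>A \<times> T\<close>. The net conditions provide for each
  \<open>x\<close> an object \<open>\<sigma> x = (v, t)\<close> of \<open>A \<times> T\<close> with \<open>(w, x) \<le> \<sigma> x \<le> (w, x + \<epsilon>)\<close>, the last coordinate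
  being cut off at \<open>sup X\<close>: take \<open>v\<close> within \<open>\<epsilon>\<^sub>A\<close> of \<open>w\<close> and \<open>t\<close> within \<open>\<epsilon>\<^sub>T\<close> above \<open>x + \<epsilon>\<^sub>A\<close>. One
  \<open>\<epsilon>\<^sub>A\<close> pays for the way from \<open>w\<close> to \<open>v\<close>, the other for the way back
  (\<open>spacetime_net_between\<close>).
  
  Such intermediate objects give the interleavings. For the left extension, \<open>H(w, x)\<close> is sent to
  \<open>H(\<sigma> x)\<close> and from there into the colimit at \<open>(w, x + \<epsilon>)\<close>, while the colimit at \<open>(w, x)\<close> is sent to
  \<open>H(w, x + \<epsilon>)\<close> by its universal property. For the right extension, \<open>H(w, x)\<close> is sent to the family
  of its images in the limit at \<open>(w, x + \<epsilon>)\<close>, and a compatible family at \<open>(w, x)\<close> is evaluated at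
  \<open>\<sigma> x\<close> and moved on to \<open>H(w, x + \<epsilon>)\<close>. The first of these two maps passes through \<open>H(\<sigma> x)\<close>, hence
  through the colimit, and so takes values in the image of the colimit in the limit; therefore the
  same two maps interleave the center extension. All composites are shift maps because \<open>H\<close> is a
  functor (\<open>interleaved_left\<close>, \<open>interleaved_right\<close>, \<open>interleaved_center\<close>).
  
  The delicate point is naturality, since different intermediate objects need not induce the same
  map into a colimit or out of a limit. They do if they are comparable. For this reason one
  direction \<open>v\<close> is chosen for the whole line: then the \<open>\<sigma> x\<close> differ only in the second coordinate,
  which is totally ordered.
  
  That \<open>H\<close> is a functor on the space-time pre-order rests on the inequality
  \<open>\<langle>x, w\<rangle> \<le> cos (arccos \<langle>x, v\<rangle> - arccos \<langle>v, w\<rangle>)\<close> for \<open>x\<close> in the unit ball and unit vectors \<open>v\<close>, \<open>w\<close>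
  (\<open>inner_prod_le_cos_diff\<close>). It yields both the triangle inequality of the angular distance and
  the inclusions of the sublevel sets.
\<close>

section \<open>Linear maps and quotients\<close>

lemma scalars_simps [simp]:
  "carrier scalars = UNIV" "mult scalars = (*)" "one scalars = 1" "zero scalars = 0"
  "add scalars = (+)"
  by (simp_all add: scalars_def)

lemma cring_scalars: "cring (scalars :: 'k::field ring)"
proof (rule cringI)
  show "abelian_group (scalars :: 'k ring)"
  proof (rule abelian_groupI)
    fix x :: 'k
    show "\<exists>y\<in>carrier scalars. y \<oplus>\<^bsub>scalars\<^esub> x = \<zero>\<^bsub>scalars\<^esub>"
      by (auto intro: exI[of _ "- x"])
  qed (auto simp: algebra_simps)
  show "Group.comm_monoid (scalars :: 'k ring)"
    by (rule comm_monoidI) (auto simp: algebra_simps)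
qed (auto simp: algebra_simps)

lemma linear_mapsI:
  assumes "\<And>x. x \<in> carrier U \<Longrightarrow> f x \<in> carrier V"
    and "\<And>x y. x \<in> carrier U \<Longrightarrow> y \<in> carrier U \<Longrightarrow> f (x \<oplus>\<^bsub>U\<^esub> y) = f x \<oplus>\<^bsub>V\<^esub> f y"
    and "\<And>a x. x \<in> carrier U \<Longrightarrow> f (a \<odot>\<^bsub>U\<^esub> x) = a \<odot>\<^bsub>V\<^esub> f x"
  shows "f \<in> linear_maps U V"
  using assms by (auto simp: linear_maps_def)

lemma linear_mapsD:
  assumes "f \<in> linear_maps U V" and "x \<in> carrier U"
  shows "f x \<in> carrier V"
    and "y \<in> carrier U \<Longrightarrow> f (x \<oplus>\<^bsub>U\<^esub> y) = f x \<oplus>\<^bsub>V\<^esub> f y"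
    and "f (a \<odot>\<^bsub>U\<^esub> x) = a \<odot>\<^bsub>V\<^esub> f x"
  using assms by (auto simp: linear_maps_def)

lemma linear_maps_comp:
  assumes "f \<in> linear_maps U V" and "g \<in> linear_maps V W"
  shows "(\<lambda>x. g (f x)) \<in> linear_maps U W"
  using assms by (intro linear_mapsI) (simp_all add: linear_mapsD)

lemma submodule_contains_zero: "submodule W scalars V \<Longrightarrow> \<zero>\<^bsub>V\<^esub> \<in> W"
  using submodule.axioms(1) subgroup.one_closed by fastforce

context
  fixes U :: "('k::field, 'a) module" and V :: "('k, 'b) module" and f
  assumes U: "module scalars U" and V: "module scalars V" and f: "f \<in> linear_maps U V"
begin

interpretation U: module scalars U by (fact U)
interpretation V: module scalars V by (fact V)

lemma linear_map_zero: "f \<zero>\<^bsub>U\<^esub> = \<zero>\<^bsub>V\<^esub>"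
proof -
  have "f \<zero>\<^bsub>U\<^esub> = f (0 \<odot>\<^bsub>U\<^esub> \<zero>\<^bsub>U\<^esub>)"
    using U.smult_l_null[of "\<zero>\<^bsub>U\<^esub>"] by simp
  also have "\<dots> = 0 \<odot>\<^bsub>V\<^esub> f \<zero>\<^bsub>U\<^esub>"
    by (rule linear_mapsD(3)[OF f]) simp
  also have "\<dots> = \<zero>\<^bsub>V\<^esub>"
    using V.smult_l_null[of "f \<zero>\<^bsub>U\<^esub>"] linear_mapsD(1)[OF f] by simp
  finally show ?thesis .
qed

lemma linear_map_uminus:
  assumes "x \<in> carrier U"
  shows "f (\<ominus>\<^bsub>U\<^esub> x) = \<ominus>\<^bsub>V\<^esub> f x"
proof -
  have "f (\<ominus>\<^bsub>U\<^esub> x) \<oplus>\<^bsub>V\<^esub> f x = \<zero>\<^bsub>V\<^esub>"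
    using assms linear_mapsD(2)[OF f, of "\<ominus>\<^bsub>U\<^esub> x" x] by (simp add: U.l_neg linear_map_zero)
  then show ?thesis
    using assms by (intro V.minus_equality[symmetric]) (simp_all add: linear_mapsD(1)[OF f])
qed

lemma linear_map_minus:
  assumes "x \<in> carrier U" and "y \<in> carrier U"
  shows "f (x \<ominus>\<^bsub>U\<^esub> y) = f x \<ominus>\<^bsub>V\<^esub> f y"
  using assms by (simp add: a_minus_def linear_mapsD(2)[OF f] linear_map_uminus)

lemma submodule_preimage:
  assumes "submodule W scalars V"
  shows "submodule {x \<in> carrier U. f x \<in> W} scalars U"
proof (rule U.submoduleI)
  show "\<zero>\<^bsub>U\<^esub> \<in> {x \<in> carrier U. f x \<in> W}"
    using submodule_contains_zero[OF assms] linear_map_zero by simp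
qed (use V.submoduleE[OF assms] in \<open>auto simp: linear_mapsD(2,3)[OF f] linear_map_uminus\<close>)

lemma submodule_image:
  assumes "submodule Z scalars U"
  shows "submodule (f ` Z) scalars V"
proof (rule V.submoduleI)
  note Z = U.submoduleE[OF assms]
  show "\<zero>\<^bsub>V\<^esub> \<in> f ` Z"
    using submodule_contains_zero[OF assms] linear_map_zero by (metis image_eqI)
  show "f ` Z \<subseteq> carrier V"
    using Z(1) linear_mapsD(1)[OF f] by auto
  show "\<ominus>\<^bsub>V\<^esub> y \<in> f ` Z" if y: "y \<in> f ` Z" for y
  proof -
    obtain z where z: "z \<in> Z" "y = f z" using y by auto
    then have "\<ominus>\<^bsub>V\<^esub> y = f (\<ominus>\<^bsub>U\<^esub> z)" using Z(1) linear_map_uminus by auto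
    then show ?thesis using Z(3) z by auto
  qed
  show "y \<oplus>\<^bsub>V\<^esub> y' \<in> f ` Z" if y: "y \<in> f ` Z" "y' \<in> f ` Z" for y y'
  proof -
    obtain z z' where z: "z \<in> Z" "y = f z" "z' \<in> Z" "y' = f z'" using y by auto
    then have "y \<oplus>\<^bsub>V\<^esub> y' = f (z \<oplus>\<^bsub>U\<^esub> z')" using Z(1) linear_mapsD(2)[OF f, of z z'] by (auto simp: subset_iff)
    then show ?thesis using Z(5) z by auto
  qed
  show "a \<odot>\<^bsub>V\<^esub> y \<in> f ` Z" if y: "y \<in> f ` Z" for a y
  proof -
    obtain z where z: "z \<in> Z" "y = f z" using y by auto
    then have "a \<odot>\<^bsub>V\<^esub> y = f (a \<odot>\<^bsub>U\<^esub> z)" using Z(1) linear_mapsD(3)[OF f, of z a] by auto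
    then show ?thesis using Z(4) z by auto
  qed
qed

end

lemma submodule_zero:
  fixes V :: "('k::field, 'a) module"
  assumes "module scalars V"
  shows "submodule {\<zero>\<^bsub>V\<^esub>} scalars V"
proof -
  interpret module scalars V by fact
  show ?thesis by (rule submoduleI) auto
qed

lemma submodule_abelian_subgroup:
  fixes V :: "('k::field, 'a) module"
  assumes "module scalars V" and "submodule W scalars V"
  shows "abelian_subgroup W V"
proof -
  interpret module scalars V by fact
  show ?thesis
    using submodule.axioms(1)[OF assms(2)]
    by (intro abelian_subgroupI3 additive_subgroup.intro) (auto intro: M.abelian_group_axioms)
qed

lemma span_in_submodule:
  fixes V :: "('k::field, 'a) module"
  assumes "module scalars V" and "S \<subseteq> carrier V"
  shows "submodule (span_in V S) scalars V"
proof -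
  interpret module scalars V by fact
  have c: "submodule (carrier V) scalars V" by (rule carrier_is_submodule)
  show ?thesis
  proof (rule submoduleI)
    show "span_in V S \<subseteq> carrier V"
      using c assms(2) by (auto simp: span_in_def)
  qed (use submoduleE in \<open>auto simp: span_in_def submodule_contains_zero\<close>)
qed

lemma span_in_superset: "S \<subseteq> span_in V S"
  by (auto simp: span_in_def)

lemma span_in_least: "submodule W scalars V \<Longrightarrow> S \<subseteq> W \<Longrightarrow> span_in V S \<subseteq> W"
  by (auto simp: span_in_def)

lemma linear_map_span_subset:
  fixes U :: "('k::field, 'a) module" and V :: "('k, 'b) module"
  assumes "module scalars U" "module scalars V" "f \<in> linear_maps U V"
    and "submodule W scalars V" "S \<subseteq> carrier U" "f ` S \<subseteq> W"
  shows "f ` span_in U S \<subseteq> W"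
  using span_in_least[OF submodule_preimage[OF assms(1-4)], of S] assms(5,6) by auto

context
  fixes V :: "('k::field, 'a) module" and W
  assumes V: "module scalars V" and W: "submodule W scalars V"
begin

interpretation V: module scalars V by (fact V)
interpretation W: abelian_subgroup W V by (rule submodule_abelian_subgroup[OF V W])

lemma coset_eqI:
  assumes "x \<in> carrier V" "y \<in> carrier V" "x \<ominus>\<^bsub>V\<^esub> y \<in> W"
  shows "W +>\<^bsub>V\<^esub> x = W +>\<^bsub>V\<^esub> y"
proof -
  have "x \<in> W +>\<^bsub>V\<^esub> y"
    using assms by (intro W.a_rcos_module_rev) (simp_all add: a_minus_def)
  then show ?thesis
    using W.a_repr_independence'[of x y] assms(2) by simp
qed

text \<open>
  The addition and the scalar multiplication of a quotient space are set operations on cosets. Once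
  they are computed on representatives, every map between quotients can be handled through its
  effect on representatives.
\<close>

lemma set_add_coset:
  assumes "x \<in> carrier V" "y \<in> carrier V"
  shows "(W +>\<^bsub>V\<^esub> x) <+>\<^bsub>V\<^esub> (W +>\<^bsub>V\<^esub> y) = W +>\<^bsub>V\<^esub> (x \<oplus>\<^bsub>V\<^esub> y)"
  using assms by (rule W.a_rcos_sum)

text \<open>
  A quotient is taken of a subspace \<open>Z\<close> of an ambient space \<open>V\<close>, because cycles form a subspace of
  the chains. Cosets, sums and scalar multiples are those of \<open>V\<close>; only the carrier depends on \<open>Z\<close>.
\<close>

lemma quotient_carrier:
  "carrier (quotient_space (V\<lparr>carrier := Z\<rparr>) W) = (\<lambda>z. W +>\<^bsub>V\<^esub> z) ` Z"
  by (auto simp: quotient_space_def A_RCOSETS_def' a_r_coset_def')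

lemma quotient_add:
  "C \<oplus>\<^bsub>quotient_space (V\<lparr>carrier := Z\<rparr>) W\<^esub> C' = C <+>\<^bsub>V\<^esub> C'"
  by (simp add: quotient_space_def set_add_def set_mult_def)

lemma quotient_smult:
  "a \<odot>\<^bsub>quotient_space (V\<lparr>carrier := Z\<rparr>) W\<^esub> C = W <+>\<^bsub>V\<^esub> (\<lambda>x. a \<odot>\<^bsub>V\<^esub> x) ` C"
  by (simp add: quotient_space_def set_add_def set_mult_def)

lemma quotient_zero:
  "\<zero>\<^bsub>quotient_space (V\<lparr>carrier := Z\<rparr>) W\<^esub> = W +>\<^bsub>V\<^esub> \<zero>\<^bsub>V\<^esub>"
  using W.a_subset V.a_coset_add_zero by (simp add: quotient_space_def)

end

text \<open>
  The sum with \<open>W'\<close> fills up the image of a coset, which lies in a single coset of \<open>W'\<close>. The maps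
  between the homology groups and between the colimits, and scalar multiplication on a quotient,
  are all of this form.
\<close>

lemma induced_coset:
  fixes V :: "('k::field, 'a) module" and V' :: "('k, 'b) module"
  assumes V: "module scalars V" and W: "submodule W scalars V"
    and V': "module scalars V'" and W': "submodule W' scalars V'"
    and f: "f \<in> linear_maps V V'" and fW: "f ` W \<subseteq> W'" and x: "x \<in> carrier V"
  shows "W' <+>\<^bsub>V'\<^esub> f ` (W +>\<^bsub>V\<^esub> x) = W' +>\<^bsub>V'\<^esub> f x"
proof -
  interpret V: module scalars V by fact
  interpret V': module scalars V' by fact
  note sW = V.submoduleE(1)[OF W] and sW' = V'.submoduleE(1,5)[OF W']
  have fx: "f x \<in> carrier V'" using linear_mapsD(1)[OF f x] .
  have fwx: "f (w \<oplus>\<^bsub>V\<^esub> x) = f w \<oplus>\<^bsub>V'\<^esub> f x" if "w \<in> W" for w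
    using linear_mapsD(2)[OF f _ x, of w] that sW by auto
  show ?thesis
  proof (intro equalityI subsetI)
    fix y assume "y \<in> W' <+>\<^bsub>V'\<^esub> f ` (W +>\<^bsub>V\<^esub> x)"
    then obtain w' w where w: "w' \<in> W'" "w \<in> W" "y = w' \<oplus>\<^bsub>V'\<^esub> (f w \<oplus>\<^bsub>V'\<^esub> f x)"
      using fwx by (auto simp: set_add_def set_mult_def a_r_coset_def')
    then have fw: "f w \<in> W'" using fW by auto
    then have "y = (w' \<oplus>\<^bsub>V'\<^esub> f w) \<oplus>\<^bsub>V'\<^esub> f x"
      using w fx sW' by (simp add: V'.a_assoc subset_iff)
    then show "y \<in> W' +>\<^bsub>V'\<^esub> f x"
      using w fw sW' by (auto simp: a_r_coset_def')
  next
    fix y assume "y \<in> W' +>\<^bsub>V'\<^esub> f x"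
    then obtain w' where w: "w' \<in> W'" "y = w' \<oplus>\<^bsub>V'\<^esub> f x"
      by (auto simp: a_r_coset_def')
    moreover have "x \<in> W +>\<^bsub>V\<^esub> x"
      using x submodule_contains_zero[OF W] by (force simp: a_r_coset_def')
    ultimately show "y \<in> W' <+>\<^bsub>V'\<^esub> f ` (W +>\<^bsub>V\<^esub> x)"
      by (auto simp: set_add_def set_mult_def)
  qed
qed

lemma smult_linear:
  fixes V :: "('k::field, 'a) module"
  assumes "module scalars V"
  shows "(\<lambda>x. a \<odot>\<^bsub>V\<^esub> x) \<in> linear_maps V V"
proof -
  interpret module scalars V by fact
  have "a \<odot>\<^bsub>V\<^esub> (b \<odot>\<^bsub>V\<^esub> x) = b \<odot>\<^bsub>V\<^esub> (a \<odot>\<^bsub>V\<^esub> x)" if "x \<in> carrier V" for b x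
    using that smult_assoc1[of a b x] smult_assoc1[of b a x] by (simp add: mult.commute)
  then show ?thesis
    using smult_r_distr by (intro linear_mapsI) auto
qed

lemma smult_coset:
  fixes V :: "('k::field, 'a) module"
  assumes V: "module scalars V" and W: "submodule W scalars V" and "x \<in> carrier V"
  shows "W <+>\<^bsub>V\<^esub> (\<lambda>x. a \<odot>\<^bsub>V\<^esub> x) ` (W +>\<^bsub>V\<^esub> x) = W +>\<^bsub>V\<^esub> (a \<odot>\<^bsub>V\<^esub> x)"
proof -
  interpret module scalars V by fact
  show ?thesis
    by (rule induced_coset[OF V W V W smult_linear[OF V] _ assms(3)])
      (use submoduleE(4)[OF W] in auto)
qed

lemma coset_map_linear:
  fixes V :: "('k::field, 'a) module"
  assumes V: "module scalars V" and W: "submodule W scalars V"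
    and Z: "Z \<subseteq> carrier V"
  shows "(\<lambda>x. W +>\<^bsub>V\<^esub> x) \<in> linear_maps (V\<lparr>carrier := Z\<rparr>) (quotient_space (V\<lparr>carrier := Z\<rparr>) W)"
  using Z set_add_coset[OF V W] smult_coset[OF V W]
  by (intro linear_mapsI)
    (auto simp: quotient_carrier[OF V W] quotient_add[OF V W] quotient_smult[OF V W] subset_iff)

text \<open>
  For an arbitrary pair of subspaces \<open>Z\<close> and \<open>W\<close>, the space in question is the image of \<open>Z\<close> in
  \<open>V / W\<close>.
\<close>

lemma quotient_space_module:
  fixes V :: "('k::field, 'a) module"
  assumes V: "module scalars V" and W: "submodule W scalars V" and Z: "submodule Z scalars V"
  shows "module scalars (quotient_space (V\<lparr>carrier := Z\<rparr>) W)"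
proof -
  interpret V: module scalars V by fact
  note sub = V.submoduleE[OF Z] submodule_contains_zero[OF Z]
  have c: "z \<in> Z \<Longrightarrow> z \<in> carrier V" for z using sub(1) by auto
  note q = quotient_carrier[OF V W] quotient_add[OF V W] quotient_smult[OF V W]
    quotient_zero[OF V W]
  note s = q set_add_coset[OF V W] smult_coset[OF V W] c sub
  show ?thesis
  proof (rule moduleI[OF cring_scalars])
    show "abelian_group (quotient_space (V\<lparr>carrier := Z\<rparr>) W)"
    proof (rule abelian_groupI)
      fix C assume "C \<in> carrier (quotient_space (V\<lparr>carrier := Z\<rparr>) W)"
      then obtain z where z: "z \<in> Z" "C = W +>\<^bsub>V\<^esub> z" by (auto simp: q)
      then have "(W +>\<^bsub>V\<^esub> (\<ominus>\<^bsub>V\<^esub> z)) <+>\<^bsub>V\<^esub> C = W +>\<^bsub>V\<^esub> \<zero>\<^bsub>V\<^esub>"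
        by (simp add: s V.l_neg)
      then show "\<exists>C'\<in>carrier (quotient_space (V\<lparr>carrier := Z\<rparr>) W).
          C' \<oplus>\<^bsub>quotient_space (V\<lparr>carrier := Z\<rparr>) W\<^esub> C = \<zero>\<^bsub>quotient_space (V\<lparr>carrier := Z\<rparr>) W\<^esub>"
        using z sub(3) unfolding q by blast
    qed (auto simp: s V.a_assoc V.a_comm V.a_lcomm)
    show "\<one>\<^bsub>scalars\<^esub> \<odot>\<^bsub>quotient_space (V\<lparr>carrier := Z\<rparr>) W\<^esub> C = C"
      if "C \<in> carrier (quotient_space (V\<lparr>carrier := Z\<rparr>) W)" for C
      using that V.smult_one by (auto simp: s)
  qed (use V.smult_l_distr V.smult_r_distr V.smult_assoc1 in \<open>auto simp: s\<close>)
qed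

lemma induced_linear:
  fixes V :: "('k::field, 'a) module" and V' :: "('k, 'b) module"
  assumes V: "module scalars V" and W: "submodule W scalars V" and Z: "submodule Z scalars V"
    and V': "module scalars V'" and W': "submodule W' scalars V'"
    and Z': "submodule Z' scalars V'"
    and f: "f \<in> linear_maps V V'" and fW: "f ` W \<subseteq> W'" and fZ: "f ` Z \<subseteq> Z'"
  shows "(\<lambda>C. W' <+>\<^bsub>V'\<^esub> f ` C)
     \<in> linear_maps (quotient_space (V\<lparr>carrier := Z\<rparr>) W) (quotient_space (V'\<lparr>carrier := Z'\<rparr>) W')"
proof -
  interpret V: module scalars V by fact
  interpret V': module scalars V' by fact
  have c: "z \<in> Z \<Longrightarrow> z \<in> carrier V" for z using V.submoduleE(1)[OF Z] by auto
  have c': "z \<in> Z \<Longrightarrow> f z \<in> Z'" "z \<in> Z \<Longrightarrow> f z \<in> carrier V'" for z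
    using fZ V'.submoduleE(1)[OF Z'] by auto
  note s = quotient_carrier[OF V W] quotient_add[OF V W] quotient_smult[OF V W]
    quotient_carrier[OF V' W'] quotient_add[OF V' W'] quotient_smult[OF V' W']
    set_add_coset[OF V W] set_add_coset[OF V' W'] smult_coset[OF V W] smult_coset[OF V' W']
    induced_coset[OF V W V' W' f fW] c c' linear_mapsD(2,3)[OF f]
  show ?thesis
    using V.smult_closed by (intro linear_mapsI) (auto simp: s)
qed

text \<open>
  A linear map that vanishes on \<open>W\<close> is constant on the cosets of \<open>W\<close>, so the image of a coset is a
  singleton. Both the maps out of a colimit and the canonical map from the left to the right Kan
  extension are defined by picking its element.
\<close>

lemma descended_coset:
  fixes V :: "('k::field, 'a) module" and U :: "('k, 'b) module"
  assumes V: "module scalars V" and W: "submodule W scalars V" and U: "module scalars U"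
    and h: "h \<in> linear_maps V U" and hW: "h ` W \<subseteq> {\<zero>\<^bsub>U\<^esub>}" and x: "x \<in> carrier V"
  shows "the_elem (h ` (W +>\<^bsub>V\<^esub> x)) = h x"
proof -
  interpret V: module scalars V by fact
  interpret U: module scalars U by fact
  have "h (w \<oplus>\<^bsub>V\<^esub> x) = h x" if "w \<in> W" for w
  proof -
    have "w \<in> carrier V" and "h w = \<zero>\<^bsub>U\<^esub>"
      using that V.submoduleE(1)[OF W] hW by auto
    then show ?thesis
      using linear_mapsD(2)[OF h _ x, of w] linear_mapsD(1)[OF h x] by simp
  qed
  moreover obtain w where "w \<in> W"
    using V.submoduleE(2)[OF W] by blast
  ultimately have "h ` (W +>\<^bsub>V\<^esub> x) = {h x}"
    by (auto simp: a_r_coset_def' image_UN)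
  then show ?thesis by simp
qed

lemma descended_linear:
  fixes V :: "('k::field, 'a) module" and U :: "('k, 'b) module"
  assumes V: "module scalars V" and W: "submodule W scalars V" and U: "module scalars U"
    and h: "h \<in> linear_maps V U" and hW: "h ` W \<subseteq> {\<zero>\<^bsub>U\<^esub>}"
  shows "(\<lambda>C. the_elem (h ` C)) \<in> linear_maps (quotient_space V W) U"
proof -
  interpret V: module scalars V by fact
  note s = quotient_carrier[OF V W, where Z = "carrier V", simplified]
    quotient_add[OF V W, where Z = "carrier V", simplified]
    quotient_smult[OF V W, where Z = "carrier V", simplified]
    set_add_coset[OF V W] smult_coset[OF V W] descended_coset[OF V W U h hW]
  show ?thesis
    using linear_mapsD[OF h] V.smult_closed by (intro linear_mapsI) (auto simp: s)
qed

section \<open>Direct products and direct sums\<close>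

lemma direct_product_simps:
  "carrier (direct_product J V) = (\<Pi>\<^sub>E j\<in>J. carrier (V j))"
  "\<zero>\<^bsub>direct_product J V\<^esub> = (\<lambda>j\<in>J. \<zero>\<^bsub>V j\<^esub>)"
  "f \<oplus>\<^bsub>direct_product J V\<^esub> g = (\<lambda>j\<in>J. f j \<oplus>\<^bsub>V j\<^esub> g j)"
  "a \<odot>\<^bsub>direct_product J V\<^esub> f = (\<lambda>j\<in>J. a \<odot>\<^bsub>V j\<^esub> f j)"
  by (simp_all add: direct_product_def)

lemma direct_sum_simps:
  "carrier (direct_sum J V)
     = {f \<in> \<Pi>\<^sub>E j\<in>J. carrier (V j). finite {j\<in>J. f j \<noteq> \<zero>\<^bsub>V j\<^esub>}}"
  "\<zero>\<^bsub>direct_sum J V\<^esub> = (\<lambda>j\<in>J. \<zero>\<^bsub>V j\<^esub>)"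
  "f \<oplus>\<^bsub>direct_sum J V\<^esub> g = (\<lambda>j\<in>J. f j \<oplus>\<^bsub>V j\<^esub> g j)"
  "a \<odot>\<^bsub>direct_sum J V\<^esub> f = (\<lambda>j\<in>J. a \<odot>\<^bsub>V j\<^esub> f j)"
  by (simp_all add: direct_sum_def direct_product_def)

context
  fixes J :: "'i set" and V :: "'i \<Rightarrow> ('k::field, 'a) module"
  assumes V: "\<And>j. j \<in> J \<Longrightarrow> module scalars (V j)"
  notes [simp] = direct_product_simps direct_sum_simps
begin

lemma fibre_group: "j \<in> J \<Longrightarrow> abelian_group (V j)"
  using V module.axioms(2) by blast

lemma fibre_minus_zero: "j \<in> J \<Longrightarrow> \<ominus>\<^bsub>V j\<^esub> \<zero>\<^bsub>V j\<^esub> = \<zero>\<^bsub>V j\<^esub>"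
  using monoid.inv_one[OF group.is_monoid[OF abelian_group.a_group[OF fibre_group]]] by (simp add: a_inv_def)

lemma direct_product_module: "module scalars (direct_product J V)"
proof (rule moduleI[OF cring_scalars])
  note grp = abelian_group.axioms(1)[OF fibre_group]
  note fibre = abelian_monoid.a_closed[OF grp] abelian_monoid.zero_closed[OF grp]
    abelian_monoid.l_zero[OF grp] abelian_monoid.r_zero[OF grp]
  show "abelian_group (direct_product J V)"
  proof (rule abelian_groupI)
    fix f assume "f \<in> carrier (direct_product J V)"
    then have f: "f j \<in> carrier (V j)" if "j \<in> J" for j using that by auto
    then have "(\<lambda>j\<in>J. \<ominus>\<^bsub>V j\<^esub> f j) \<in> carrier (direct_product J V)"
      by (auto intro: abelian_group.a_inv_closed[OF fibre_group])
    moreover have "(\<lambda>j\<in>J. \<ominus>\<^bsub>V j\<^esub> f j) \<oplus>\<^bsub>direct_product J V\<^esub> f = \<zero>\<^bsub>direct_product J V\<^esub>"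
      using f by (auto intro!: ext simp: abelian_group.l_neg[OF fibre_group] restrict_def)
    ultimately show "\<exists>g\<in>carrier (direct_product J V).
        g \<oplus>\<^bsub>direct_product J V\<^esub> f = \<zero>\<^bsub>direct_product J V\<^esub>" by blast
  next
    fix f assume f: "f \<in> carrier (direct_product J V)"
    then have "f j \<in> carrier (V j)" if "j \<in> J" for j using that by auto
    then show "\<zero>\<^bsub>direct_product J V\<^esub> \<oplus>\<^bsub>direct_product J V\<^esub> f = f"
      using f by (auto intro!: ext simp: fibre restrict_def PiE_iff extensional_def)
  qed (use abelian_monoid.a_assoc[OF grp] abelian_monoid.a_comm[OF grp] in
      \<open>auto intro!: ext simp: fibre restrict_def PiE_iff extensional_def\<close>)
next
  fix f assume f: "f \<in> carrier (direct_product J V)"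
  then have "f j \<in> carrier (V j)" if "j \<in> J" for j using that by auto
  then show "\<one>\<^bsub>scalars\<^esub> \<odot>\<^bsub>direct_product J V\<^esub> f = f"
    using f module.smult_one[OF V]
    by (auto intro!: ext simp: restrict_def PiE_iff extensional_def)
qed (use module.smult_closed[OF V] module.smult_l_distr[OF V] module.smult_r_distr[OF V]
      module.smult_assoc1[OF V] in \<open>auto intro!: ext simp: restrict_def PiE_iff extensional_def\<close>)

lemma direct_sum_module: "module scalars (direct_sum J V)"
proof -
  interpret P: module scalars "direct_product J V" by (rule direct_product_module)
  have neg: "(\<ominus>\<^bsub>direct_product J V\<^esub> f) = (\<lambda>j\<in>J. \<ominus>\<^bsub>V j\<^esub> f j)"
    if f: "f \<in> carrier (direct_product J V)" for f
  proof (rule P.minus_equality)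
    have "f j \<in> carrier (V j)" if "j \<in> J" for j using f that by auto
    then show "(\<lambda>j\<in>J. \<ominus>\<^bsub>V j\<^esub> f j) \<oplus>\<^bsub>direct_product J V\<^esub> f = \<zero>\<^bsub>direct_product J V\<^esub>"
      by (auto intro!: ext simp: abelian_group.l_neg[OF fibre_group] restrict_def)
    show "(\<lambda>j\<in>J. \<ominus>\<^bsub>V j\<^esub> f j) \<in> carrier (direct_product J V)"
      using f by (auto intro: abelian_group.a_inv_closed[OF fibre_group])
  qed (rule f)
  note grp = abelian_group.axioms(1)[OF fibre_group]
  have "submodule (carrier (direct_sum J V)) scalars (direct_product J V)"
  proof (rule P.submoduleI)
    fix f assume f: "f \<in> carrier (direct_sum J V)"
    then have f': "f \<in> carrier (direct_product J V)" by simp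
    have "{j\<in>J. (\<ominus>\<^bsub>direct_product J V\<^esub> f) j \<noteq> \<zero>\<^bsub>V j\<^esub>} \<subseteq> {j\<in>J. f j \<noteq> \<zero>\<^bsub>V j\<^esub>}"
      by (auto simp: neg[OF f'] fibre_minus_zero)
    then show "\<ominus>\<^bsub>direct_product J V\<^esub> f \<in> carrier (direct_sum J V)"
      using f P.a_inv_closed[OF f'] by (auto intro: finite_subset)
  next
    fix f g assume f: "f \<in> carrier (direct_sum J V)" and g: "g \<in> carrier (direct_sum J V)"
    have "{j\<in>J. (f \<oplus>\<^bsub>direct_product J V\<^esub> g) j \<noteq> \<zero>\<^bsub>V j\<^esub>}
        \<subseteq> {j\<in>J. f j \<noteq> \<zero>\<^bsub>V j\<^esub>} \<union> {j\<in>J. g j \<noteq> \<zero>\<^bsub>V j\<^esub>}"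
      using abelian_monoid.l_zero[OF grp] abelian_monoid.zero_closed[OF grp] by auto
    then have "finite {j\<in>J. (f \<oplus>\<^bsub>direct_product J V\<^esub> g) j \<noteq> \<zero>\<^bsub>V j\<^esub>}"
      by (rule finite_subset) (use f g in auto)
    then show "f \<oplus>\<^bsub>direct_product J V\<^esub> g \<in> carrier (direct_sum J V)"
      using f g P.a_closed[of f g] by simp
  next
    fix a f assume f: "f \<in> carrier (direct_sum J V)"
    have "{j\<in>J. (a \<odot>\<^bsub>direct_product J V\<^esub> f) j \<noteq> \<zero>\<^bsub>V j\<^esub>} \<subseteq> {j\<in>J. f j \<noteq> \<zero>\<^bsub>V j\<^esub>}"
      using module.smult_r_null[OF V] by auto
    then have "finite {j\<in>J. (a \<odot>\<^bsub>direct_product J V\<^esub> f) j \<noteq> \<zero>\<^bsub>V j\<^esub>}"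
      by (rule finite_subset) (use f in auto)
    then show "a \<odot>\<^bsub>direct_product J V\<^esub> f \<in> carrier (direct_sum J V)"
      using f P.smult_closed[of a f] by simp
  qed (use abelian_monoid.zero_closed[OF grp] in auto)
  then have "module scalars ((direct_product J V)\<lparr>carrier := carrier (direct_sum J V)\<rparr>)"
    using submodule.submodule_is_module direct_product_module by blast
  then show ?thesis
    by (simp add: direct_sum_def)
qed

lemma direct_sum_inj_linear:
  assumes "i \<in> J"
  shows "direct_sum_inj J V i \<in> linear_maps (V i) (direct_sum J V)"
proof (rule linear_mapsI)
  note grp = abelian_group.axioms(1)[OF fibre_group]
  note zero = abelian_monoid.zero_closed[OF grp] abelian_monoid.l_zero[OF grp]
  fix x assume x: "x \<in> carrier (V i)"
  have "{j \<in> J. direct_sum_inj J V i x j \<noteq> \<zero>\<^bsub>V j\<^esub>} \<subseteq> {i}"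
    by (auto simp: direct_sum_inj_def)
  then show "direct_sum_inj J V i x \<in> carrier (direct_sum J V)"
    using x zero by (auto simp: direct_sum_inj_def intro: finite_subset)
  show "direct_sum_inj J V i (x \<oplus>\<^bsub>V i\<^esub> y)
      = direct_sum_inj J V i x \<oplus>\<^bsub>direct_sum J V\<^esub> direct_sum_inj J V i y" for y
    using zero by (auto intro!: ext simp: direct_sum_inj_def restrict_def)
  show "direct_sum_inj J V i (a \<odot>\<^bsub>V i\<^esub> x) = a \<odot>\<^bsub>direct_sum J V\<^esub> direct_sum_inj J V i x" for a
    using module.smult_r_null[OF V] by (auto intro!: ext simp: direct_sum_inj_def restrict_def)
qed

text \<open>
  Induction on the size of the support: one component is split off at a time.
\<close>

lemma direct_sum_induct [consumes 1, case_names zero add]: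
  assumes "f \<in> carrier (direct_sum J V)"
    and zero: "P \<zero>\<^bsub>direct_sum J V\<^esub>"
    and add: "\<And>i x f. i \<in> J \<Longrightarrow> x \<in> carrier (V i) \<Longrightarrow> f \<in> carrier (direct_sum J V) \<Longrightarrow> P f
       \<Longrightarrow> P (direct_sum_inj J V i x \<oplus>\<^bsub>direct_sum J V\<^esub> f)"
  shows "P f"
  using assms(1)
proof (induction "card {j\<in>J. f j \<noteq> \<zero>\<^bsub>V j\<^esub>}" arbitrary: f)
  case 0
  then have "f j = \<zero>\<^bsub>V j\<^esub>" if "j \<in> J" for j using that by auto
  then have "f = \<zero>\<^bsub>direct_sum J V\<^esub>"
    using 0 by (auto intro!: ext simp: restrict_def PiE_iff extensional_def)
  then show ?case using zero by metis
next
  case (Suc n)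
  note grp = abelian_group.axioms(1)[OF fibre_group]
  note fibre = abelian_monoid.zero_closed[OF grp] abelian_monoid.r_zero[OF grp]
    abelian_monoid.l_zero[OF grp]
  let ?S = "{j\<in>J. f j \<noteq> \<zero>\<^bsub>V j\<^esub>}"
  have fin: "finite ?S" and f: "f \<in> (\<Pi>\<^sub>E j\<in>J. carrier (V j))" using Suc.prems by auto
  have "?S \<noteq> {}" using Suc.hyps(2) by (metis card.empty nat.distinct(1))
  then obtain i where i: "i \<in> J" "f i \<noteq> \<zero>\<^bsub>V i\<^esub>" by blast
  define g where "g = (\<lambda>j\<in>J. if j = i then \<zero>\<^bsub>V j\<^esub> else f j)"
  have supp: "{j\<in>J. g j \<noteq> \<zero>\<^bsub>V j\<^esub>} = ?S - {i}" by (auto simp: g_def)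
  then have "card {j\<in>J. g j \<noteq> \<zero>\<^bsub>V j\<^esub>} = n" using Suc.hyps(2)[symmetric] fin i
    by (simp add: card_Diff_singleton)
  moreover have g: "g \<in> carrier (direct_sum J V)"
    using supp fin f fibre(1) by (auto simp: g_def PiE_iff)
  ultimately have "P g" using Suc.hyps(1) by blast
  moreover have "f = direct_sum_inj J V i (f i) \<oplus>\<^bsub>direct_sum J V\<^esub> g"
    using f i
    by (auto intro!: ext simp: direct_sum_inj_def g_def PiE_iff extensional_def restrict_def fibre)
  ultimately show ?case
    using add[OF i(1) _ g, of "f i"] f i by (simp add: PiE_iff)
qed

text \<open>
  The uniqueness half of the universal property of the direct sum. Equations between maps out of
  colimits are checked by means of it on single components, so that sums over supports appear
  only in the construction of the maps.
\<close>

lemma direct_sum_linear_ext: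
  fixes U :: "('k, 'b) module"
  assumes U: "module scalars U"
    and F: "F \<in> linear_maps (direct_sum J V) U" and G: "G \<in> linear_maps (direct_sum J V) U"
    and eq: "\<And>i x. i \<in> J \<Longrightarrow> x \<in> carrier (V i) \<Longrightarrow>
       F (direct_sum_inj J V i x) = G (direct_sum_inj J V i x)"
    and f: "f \<in> carrier (direct_sum J V)"
  shows "F f = G f"
  using f
proof (induction rule: direct_sum_induct)
  case zero
  then show ?case
    using linear_map_zero[OF direct_sum_module U F] linear_map_zero[OF direct_sum_module U G]
    by metis
next
  case (add i x f)
  then have "direct_sum_inj J V i x \<in> carrier (direct_sum J V)"
    using direct_sum_inj_linear linear_mapsD(1) by fast
  then show ?case
    using add eq linear_mapsD(2)[OF F, of "direct_sum_inj J V i x" f]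
      linear_mapsD(2)[OF G, of "direct_sum_inj J V i x" f] by metis
qed

end

section \<open>Colimits of vector spaces\<close>

text \<open>
  A diagram on all of \<open>P\<close>. It restricts to the indexing sets of the Kan extensions and to the
  lines along which they are compared.
\<close>

locale transitive_diagram =
  fixes P :: "'i set" and R :: "'i \<Rightarrow> 'i \<Rightarrow> bool" and D :: "('i, 'k::field, 'a) diagram"
  assumes R_trans: "p \<in> P \<Longrightarrow> q \<in> P \<Longrightarrow> r \<in> P \<Longrightarrow> R p q \<Longrightarrow> R q r \<Longrightarrow> R p r"
    and ob_module: "p \<in> P \<Longrightarrow> module scalars (ob D p)"
    and ar_linear: "p \<in> P \<Longrightarrow> q \<in> P \<Longrightarrow> R p q \<Longrightarrow> ar D p q \<in> linear_maps (ob D p) (ob D q)"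
    and ar_comp: "p \<in> P \<Longrightarrow> q \<in> P \<Longrightarrow> r \<in> P \<Longrightarrow> R p q \<Longrightarrow> R q r \<Longrightarrow>
       x \<in> carrier (ob D p) \<Longrightarrow> ar D q r (ar D p q x) = ar D p r x"
begin

lemma ar_closed:
  "p \<in> P \<Longrightarrow> q \<in> P \<Longrightarrow> R p q \<Longrightarrow> x \<in> carrier (ob D p) \<Longrightarrow> ar D p q x \<in> carrier (ob D q)"
  using linear_mapsD(1)[OF ar_linear] .

definition cocone_sum :: "'i set \<Rightarrow> 'i \<Rightarrow> ('i \<Rightarrow> 'a) \<Rightarrow> 'a" where
  "cocone_sum K l f = (\<Oplus>\<^bsub>ob D l\<^esub>j\<in>{j \<in> K. f j \<noteq> \<zero>\<^bsub>ob D j\<^esub>}. ar D j l (f j))"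

text \<open>
  The map out of the colimit over \<open>K\<close> given by the cocone of the maps \<open>D(j \<rightarrow> l)\<close>.
\<close>

definition from_colimit :: "'i set \<Rightarrow> 'i \<Rightarrow> ('i \<Rightarrow> 'a) set \<Rightarrow> 'a" where
  "from_colimit K l C = the_elem (cocone_sum K l ` C)"

definition colimit_inj :: "'i set \<Rightarrow> 'i \<Rightarrow> 'a \<Rightarrow> ('i \<Rightarrow> 'a) set" where
  "colimit_inj K j x =
     colimit_relations R K D +>\<^bsub>direct_sum K (ob D)\<^esub> direct_sum_inj K (ob D) j x"

context
  fixes K :: "'i set"
  assumes K: "K \<subseteq> P"
begin

lemma index_in: "j \<in> K \<Longrightarrow> j \<in> P"
  using K by auto

lemma sum_module: "module scalars (direct_sum K (ob D))"
  using K ob_module by (intro direct_sum_module) auto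

lemma sum_inj_linear: "j \<in> K \<Longrightarrow> direct_sum_inj K (ob D) j \<in> linear_maps (ob D j) (direct_sum K (ob D))"
  using K ob_module by (intro direct_sum_inj_linear) auto

lemma sum_inj_closed:
  "j \<in> K \<Longrightarrow> x \<in> carrier (ob D j) \<Longrightarrow> direct_sum_inj K (ob D) j x \<in> carrier (direct_sum K (ob D))"
  using linear_mapsD(1)[OF sum_inj_linear] .

lemma relation_generators_closed:
  "{direct_sum_inj K (ob D) i x \<ominus>\<^bsub>direct_sum K (ob D)\<^esub> direct_sum_inj K (ob D) j (ar D i j x)
     | i j x. i \<in> K \<and> j \<in> K \<and> R i j \<and> x \<in> carrier (ob D i)} \<subseteq> carrier (direct_sum K (ob D))"
proof -
  interpret module scalars "direct_sum K (ob D)" by (rule sum_module)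
  show ?thesis
    using K sum_inj_closed ar_closed M.minus_closed by blast
qed

lemma relations_submodule: "submodule (colimit_relations R K D) scalars (direct_sum K (ob D))"
  unfolding colimit_relations_def
  by (rule span_in_submodule[OF sum_module relation_generators_closed])

text \<open>
  The relations are a span, so a linear map sends all of them into \<open>W\<close> once it does so for the
  generators. With \<open>W = 0\<close> this yields maps out of a colimit, and with the relations of another
  colimit as \<open>W\<close> it yields maps between colimits.
\<close>

lemma relations_image_subset:
  assumes U: "module scalars U" and h: "h \<in> linear_maps (direct_sum K (ob D)) U"
    and W: "submodule W scalars U"
    and gen: "\<And>i j x. i \<in> K \<Longrightarrow> j \<in> K \<Longrightarrow> R i j \<Longrightarrow> x \<in> carrier (ob D i) \<Longrightarrow>
      h (direct_sum_inj K (ob D) i x) \<ominus>\<^bsub>U\<^esub> h (direct_sum_inj K (ob D) j (ar D i j x)) \<in> W"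
  shows "h ` colimit_relations R K D \<subseteq> W"
  unfolding colimit_relations_def
proof (rule linear_map_span_subset[OF sum_module U h W relation_generators_closed])
  show "h ` {direct_sum_inj K (ob D) i x
          \<ominus>\<^bsub>direct_sum K (ob D)\<^esub> direct_sum_inj K (ob D) j (ar D i j x)
       | i j x. i \<in> K \<and> j \<in> K \<and> R i j \<and> x \<in> carrier (ob D i)} \<subseteq> W"
  proof clarify
    fix i j x assume *: "i \<in> K" "j \<in> K" "R i j" "x \<in> carrier (ob D i)"
    then have "ar D i j x \<in> carrier (ob D j)" using ar_closed index_in by blast
    then show "h (direct_sum_inj K (ob D) i x
          \<ominus>\<^bsub>direct_sum K (ob D)\<^esub> direct_sum_inj K (ob D) j (ar D i j x)) \<in> W"
      using gen[OF *] * linear_map_minus[OF sum_module U h] sum_inj_closed by simp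
  qed
qed

lemma colimit_module: "module scalars (colimit R K D)"
proof -
  interpret module scalars "direct_sum K (ob D)" by (rule sum_module)
  show ?thesis
    using quotient_space_module[OF sum_module relations_submodule carrier_is_submodule]
    by (simp add: colimit_def)
qed

lemma colimit_class_linear:
  "(\<lambda>f. colimit_relations R K D +>\<^bsub>direct_sum K (ob D)\<^esub> f)
     \<in> linear_maps (direct_sum K (ob D)) (colimit R K D)"
  using coset_map_linear[OF sum_module relations_submodule order_refl] by (simp add: colimit_def)

lemma colimit_carrier:
  "carrier (colimit R K D) =
    (\<lambda>f. colimit_relations R K D +>\<^bsub>direct_sum K (ob D)\<^esub> f) ` carrier (direct_sum K (ob D))"
  using quotient_carrier[OF sum_module relations_submodule, where Z = "carrier (direct_sum K (ob D))"]
  by (simp add: colimit_def)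

lemma colimit_inj_linear: "j \<in> K \<Longrightarrow> colimit_inj K j \<in> linear_maps (ob D j) (colimit R K D)"
  using linear_maps_comp[OF sum_inj_linear colimit_class_linear]
  by (simp add: colimit_inj_def[abs_def])

text \<open>
  This identification is what makes the choice of an intermediate object immaterial, as long as
  the objects are comparable.
\<close>

lemma colimit_inj_compat:
  assumes "i \<in> K" "j \<in> K" "R i j" "x \<in> carrier (ob D i)"
  shows "colimit_inj K j (ar D i j x) = colimit_inj K i x"
  unfolding colimit_inj_def
proof (rule coset_eqI[OF sum_module relations_submodule, symmetric])
  show "direct_sum_inj K (ob D) i x
      \<ominus>\<^bsub>direct_sum K (ob D)\<^esub> direct_sum_inj K (ob D) j (ar D i j x) \<in> colimit_relations R K D"
    using assms unfolding colimit_relations_def by (intro subsetD[OF span_in_superset]) blast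
qed (use assms sum_inj_closed ar_closed index_in in blast)+

lemma colimit_linear_ext:
  assumes U: "module scalars U"
    and F: "F \<in> linear_maps (colimit R K D) U" and G: "G \<in> linear_maps (colimit R K D) U"
    and eq: "\<And>j x. j \<in> K \<Longrightarrow> x \<in> carrier (ob D j) \<Longrightarrow> F (colimit_inj K j x) = G (colimit_inj K j x)"
    and C: "C \<in> carrier (colimit R K D)"
  shows "F C = G C"
proof -
  obtain f where f: "f \<in> carrier (direct_sum K (ob D))"
    and C: "C = colimit_relations R K D +>\<^bsub>direct_sum K (ob D)\<^esub> f"
    using C colimit_carrier by auto
  show ?thesis
    unfolding C
    by (rule direct_sum_linear_ext[OF _ U linear_maps_comp[OF colimit_class_linear F]
          linear_maps_comp[OF colimit_class_linear G] _ f])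
      (use K ob_module eq in \<open>auto simp: colimit_inj_def\<close>)
qed

context
  fixes l
  assumes l: "l \<in> P" and Kl: "\<And>j. j \<in> K \<Longrightarrow> R j l"
begin

interpretation L: module scalars "ob D l" by (rule ob_module[OF l])

lemma ar_into: "j \<in> K \<Longrightarrow> ar D j l \<in> linear_maps (ob D j) (ob D l)"
  using K l Kl ar_linear by auto

text \<open>
  The index set of the defining sum depends on the family. For additivity, the sums for \<open>f\<close>, \<open>g\<close>
  and \<open>f + g\<close> have to run over the same set.
\<close>

lemma cocone_sum_support:
  assumes f: "f \<in> carrier (direct_sum K (ob D))"
    and S: "finite S" "S \<subseteq> K" "{j \<in> K. f j \<noteq> \<zero>\<^bsub>ob D j\<^esub>} \<subseteq> S"
  shows "cocone_sum K l f = (\<Oplus>\<^bsub>ob D l\<^esub>j\<in>S. ar D j l (f j))"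
  unfolding cocone_sum_def
proof (rule L.add.finprod_mono_neutral_cong_left[OF S(1,3)])
  fix j assume "j \<in> S - {j \<in> K. f j \<noteq> \<zero>\<^bsub>ob D j\<^esub>}"
  then have "j \<in> K" "f j = \<zero>\<^bsub>ob D j\<^esub>" using S(2) by auto
  then show "ar D j l (f j) = \<zero>\<^bsub>ob D l\<^esub>"
    using linear_map_zero[OF ob_module ob_module[OF l] ar_into] K by auto
next
  show "(\<lambda>j. ar D j l (f j)) \<in> S \<rightarrow> carrier (ob D l)"
    using f S(2) linear_mapsD(1)[OF ar_into] by (auto simp: PiE_iff direct_sum_def direct_product_def)
qed simp

lemma cocone_sum_linear: "cocone_sum K l \<in> linear_maps (direct_sum K (ob D)) (ob D l)"
proof (rule linear_mapsI)
  let ?S = "\<lambda>f. {j \<in> K. f j \<noteq> \<zero>\<^bsub>ob D j\<^esub>}"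
  interpret S: module scalars "direct_sum K (ob D)" by (rule sum_module)
  have val: "f j \<in> carrier (ob D j)" "ar D j l (f j) \<in> carrier (ob D l)"
    if "f \<in> carrier (direct_sum K (ob D))" "j \<in> K" for f j
    using that linear_mapsD(1)[OF ar_into] by (auto simp: PiE_iff direct_sum_def direct_product_def)
  have fin: "finite (?S f)" if "f \<in> carrier (direct_sum K (ob D))" for f
    using that by (auto simp: direct_sum_def)
  fix f assume f: "f \<in> carrier (direct_sum K (ob D))"
  show "cocone_sum K l f \<in> carrier (ob D l)"
    unfolding cocone_sum_def using val[OF f] by (intro L.finsum_closed) auto
  show "cocone_sum K l (f \<oplus>\<^bsub>direct_sum K (ob D)\<^esub> g) = cocone_sum K l f \<oplus>\<^bsub>ob D l\<^esub> cocone_sum K l g"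
    if g: "g \<in> carrier (direct_sum K (ob D))" for g
  proof -
    let ?fg = "f \<oplus>\<^bsub>direct_sum K (ob D)\<^esub> g"
    have fg: "?fg \<in> carrier (direct_sum K (ob D))" using f g by (rule S.a_closed)
    let ?T = "?S f \<union> ?S g \<union> ?S ?fg"
    have T: "finite ?T" "?T \<subseteq> K" using fin f g fg by auto
    have "cocone_sum K l ?fg = (\<Oplus>\<^bsub>ob D l\<^esub>j\<in>?T. ar D j l (?fg j))"
      using cocone_sum_support[OF fg T] by blast
    also have "\<dots> = (\<Oplus>\<^bsub>ob D l\<^esub>j\<in>?T. ar D j l (f j) \<oplus>\<^bsub>ob D l\<^esub> ar D j l (g j))"
    proof (rule L.finsum_cong')
      fix j assume "j \<in> ?T"
      then have j: "j \<in> K" by auto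
      then have "?fg j = f j \<oplus>\<^bsub>ob D j\<^esub> g j" by (simp add: direct_sum_def direct_product_def)
      then show "ar D j l (?fg j) = ar D j l (f j) \<oplus>\<^bsub>ob D l\<^esub> ar D j l (g j)"
        using linear_mapsD(2)[OF ar_into[OF j]] val[OF f j] val[OF g j] by simp
    qed (use val[OF f] val[OF g] in auto)
    also have "\<dots> = (\<Oplus>\<^bsub>ob D l\<^esub>j\<in>?T. ar D j l (f j)) \<oplus>\<^bsub>ob D l\<^esub> (\<Oplus>\<^bsub>ob D l\<^esub>j\<in>?T. ar D j l (g j))"
      using val[OF f] val[OF g] by (intro L.finsum_addf) auto
    also have "\<dots> = cocone_sum K l f \<oplus>\<^bsub>ob D l\<^esub> cocone_sum K l g"
      using cocone_sum_support[OF f T] cocone_sum_support[OF g T] by (simp add: le_supI1)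
    finally show ?thesis .
  qed
  show "cocone_sum K l (a \<odot>\<^bsub>direct_sum K (ob D)\<^esub> f) = a \<odot>\<^bsub>ob D l\<^esub> cocone_sum K l f" for a
  proof -
    let ?af = "a \<odot>\<^bsub>direct_sum K (ob D)\<^esub> f"
    have af: "?af \<in> carrier (direct_sum K (ob D))" using f by (intro S.smult_closed) auto
    let ?T = "?S f \<union> ?S ?af"
    have T: "finite ?T" "?T \<subseteq> K" using fin f af by auto
    have "cocone_sum K l ?af = (\<Oplus>\<^bsub>ob D l\<^esub>j\<in>?T. ar D j l (?af j))"
      using cocone_sum_support[OF af T] by blast
    also have "\<dots> = (\<Oplus>\<^bsub>ob D l\<^esub>j\<in>?T. a \<odot>\<^bsub>ob D l\<^esub> ar D j l (f j))"
    proof (rule L.finsum_cong')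
      fix j assume "j \<in> ?T"
      then have j: "j \<in> K" by auto
      then have "?af j = a \<odot>\<^bsub>ob D j\<^esub> f j" by (simp add: direct_sum_def direct_product_def)
      then show "ar D j l (?af j) = a \<odot>\<^bsub>ob D l\<^esub> ar D j l (f j)"
        using linear_mapsD(3)[OF ar_into[OF j]] val[OF f j] by simp
    qed (use val[OF f] L.smult_closed in auto)
    also have "\<dots> = a \<odot>\<^bsub>ob D l\<^esub> (\<Oplus>\<^bsub>ob D l\<^esub>j\<in>?T. ar D j l (f j))"
      using val[OF f] T by (intro L.finsum_smult_ldistr[symmetric]) auto
    also have "\<dots> = a \<odot>\<^bsub>ob D l\<^esub> cocone_sum K l f"
      using cocone_sum_support[OF f T] by auto
    finally show ?thesis .
  qed
qed

lemma cocone_sum_inj: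
  assumes j: "j \<in> K" and x: "x \<in> carrier (ob D j)"
  shows "cocone_sum K l (direct_sum_inj K (ob D) j x) = ar D j l x"
proof -
  have "cocone_sum K l (direct_sum_inj K (ob D) j x)
      = (\<Oplus>\<^bsub>ob D l\<^esub>i\<in>{j}. ar D i l (direct_sum_inj K (ob D) j x i))"
    using j x by (intro cocone_sum_support sum_inj_closed) (auto simp: direct_sum_inj_def)
  also have "\<dots> = ar D j l x"
    using linear_mapsD(1)[OF ar_into[OF j] x] j by (simp add: direct_sum_inj_def)
  finally show ?thesis .
qed

lemma cocone_sum_relations: "cocone_sum K l ` colimit_relations R K D \<subseteq> {\<zero>\<^bsub>ob D l\<^esub>}"
proof (rule relations_image_subset[OF ob_module[OF l] cocone_sum_linear submodule_zero])
  fix i j x assume *: "i \<in> K" "j \<in> K" "R i j" "x \<in> carrier (ob D i)"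
  then have "ar D i j x \<in> carrier (ob D j)" and "ar D j l (ar D i j x) = ar D i l x"
    using l Kl ar_closed ar_comp index_in by blast+
  then show "cocone_sum K l (direct_sum_inj K (ob D) i x) \<ominus>\<^bsub>ob D l\<^esub>
      cocone_sum K l (direct_sum_inj K (ob D) j (ar D i j x)) \<in> {\<zero>\<^bsub>ob D l\<^esub>}"
    using * linear_mapsD(1)[OF ar_into] by (simp add: cocone_sum_inj a_minus_def L.r_neg)
qed (rule ob_module[OF l])

lemma from_colimit_linear: "from_colimit K l \<in> linear_maps (colimit R K D) (ob D l)"
  using descended_linear[OF sum_module relations_submodule ob_module[OF l] cocone_sum_linear
      cocone_sum_relations]
  by (simp add: from_colimit_def[abs_def] colimit_def)

lemma from_colimit_inj:
  assumes "j \<in> K" and "x \<in> carrier (ob D j)"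
  shows "from_colimit K l (colimit_inj K j x) = ar D j l x"
  unfolding from_colimit_def colimit_inj_def
  using descended_coset[OF sum_module relations_submodule ob_module[OF l] cocone_sum_linear
      cocone_sum_relations sum_inj_closed[OF assms]] cocone_sum_inj[OF assms] by simp

end

end

section \<open>Kan extensions\<close>

lemma extend_by_zero_linear:
  assumes K': "K' \<subseteq> P" and "K \<subseteq> K'"
  shows "(\<lambda>f. \<lambda>j\<in>K'. if j \<in> K then f j else \<zero>\<^bsub>ob D j\<^esub>)
     \<in> linear_maps (direct_sum K (ob D)) (direct_sum K' (ob D))"
proof -
  have mod: "module scalars (ob D j)" if "j \<in> K'" for j using that K' ob_module by auto
  note grp = abelian_group.axioms(1)[OF module.axioms(2)[OF mod]]
  note fibre = abelian_monoid.zero_closed[OF grp] abelian_monoid.r_zero[OF grp]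
    module.smult_r_null[OF mod]
  show ?thesis
  proof (rule linear_mapsI)
    let ?ext = "\<lambda>f. \<lambda>j\<in>K'. if j \<in> K then f j else \<zero>\<^bsub>ob D j\<^esub>"
    fix f assume f: "f \<in> carrier (direct_sum K (ob D))"
    then have "{j \<in> K'. ?ext f j \<noteq> \<zero>\<^bsub>ob D j\<^esub>} \<subseteq> {j \<in> K. f j \<noteq> \<zero>\<^bsub>ob D j\<^esub>}" by auto
    then have "finite {j \<in> K'. ?ext f j \<noteq> \<zero>\<^bsub>ob D j\<^esub>}"
      by (rule finite_subset) (use f in \<open>simp add: direct_sum_def\<close>)
    moreover have "?ext f \<in> (\<Pi>\<^sub>E j\<in>K'. carrier (ob D j))"
      using f fibre(1) by (auto simp: direct_sum_def direct_product_def PiE_iff)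
    ultimately show "?ext f \<in> carrier (direct_sum K' (ob D))"
      by (simp add: direct_sum_def direct_product_def)
    show "?ext (f \<oplus>\<^bsub>direct_sum K (ob D)\<^esub> g) = ?ext f \<oplus>\<^bsub>direct_sum K' (ob D)\<^esub> ?ext g" for g
      using fibre by (auto intro!: ext simp: direct_sum_def direct_product_def restrict_def)
    show "?ext (a \<odot>\<^bsub>direct_sum K (ob D)\<^esub> f) = a \<odot>\<^bsub>direct_sum K' (ob D)\<^esub> ?ext f" for a
      using fibre by (auto intro!: ext simp: direct_sum_def direct_product_def restrict_def)
  qed
qed

lemma extend_by_zero_inj:
  "K \<subseteq> K' \<Longrightarrow> j \<in> K \<Longrightarrow>
   (\<lambda>i\<in>K'. if i \<in> K then direct_sum_inj K (ob D) j x i else \<zero>\<^bsub>ob D i\<^esub>) = direct_sum_inj K' (ob D) j x"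
  by (rule ext) (auto simp: direct_sum_inj_def)

lemma limit_carrier:
  "f \<in> carrier (limit R K D) \<longleftrightarrow>
    f \<in> (\<Pi>\<^sub>E j\<in>K. carrier (ob D j)) \<and> (\<forall>i\<in>K. \<forall>j\<in>K. R i j \<longrightarrow> ar D i j (f i) = f j)"
  by (simp add: limit_def direct_product_def)

lemma proj_linear: "l \<in> K \<Longrightarrow> (\<lambda>f. f l) \<in> linear_maps (direct_product K V) (V l)"
  by (intro linear_mapsI) (auto simp: direct_product_def)

context
  fixes J
  assumes J: "J \<subseteq> P"
begin

lemma below_subset: "below R J p \<subseteq> P"
  using J by (auto simp: below_def)

lemma belowD: "j \<in> below R J p \<Longrightarrow> R j p" "j \<in> below R J p \<Longrightarrow> j \<in> P"
  using J by (auto simp: below_def)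

lemma aboveD: "j \<in> above R J p \<Longrightarrow> R p j" "j \<in> above R J p \<Longrightarrow> j \<in> P"
  using J by (auto simp: above_def)

lemma below_mono:
  assumes "p \<in> P" "q \<in> P" "R p q"
  shows "below R J p \<subseteq> below R J q"
  using J R_trans[OF _ assms(1,2) _ assms(3)] by (auto simp: below_def)

lemma above_mono:
  assumes "p \<in> P" "q \<in> P" "R p q"
  shows "above R J q \<subseteq> above R J p"
  using J R_trans[OF assms(1,2) _ assms(3)] by (auto simp: above_def)

lemma below_above: "p \<in> P \<Longrightarrow> j \<in> below R J p \<Longrightarrow> l \<in> above R J p \<Longrightarrow> R j l"
  by (rule R_trans[OF belowD(2) _ aboveD(2) belowD(1) aboveD(1)])

text \<open>
  Extension by zero takes generating relations to generating relations, and therefore induces a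
  map between the colimits.
\<close>

lemma extend_by_zero_relations:
  assumes "p \<in> P" "q \<in> P" "R p q"
  shows "(\<lambda>f. \<lambda>j\<in>below R J q. if j \<in> below R J p then f j else \<zero>\<^bsub>ob D j\<^esub>)
     ` colimit_relations R (below R J p) D \<subseteq> colimit_relations R (below R J q) D"
proof (rule relations_image_subset[OF below_subset sum_module[OF below_subset]
      extend_by_zero_linear[OF below_subset below_mono] relations_submodule[OF below_subset]])
  fix i j x
  assume *: "i \<in> below R J p" "j \<in> below R J p" "R i j" "x \<in> carrier (ob D i)"
  have sub: "below R J p \<subseteq> below R J q" using assms by (rule below_mono)
  then show "(\<lambda>l\<in>below R J q. if l \<in> below R J p
        then direct_sum_inj (below R J p) (ob D) i x l else \<zero>\<^bsub>ob D l\<^esub>)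
      \<ominus>\<^bsub>direct_sum (below R J q) (ob D)\<^esub>
      (\<lambda>l\<in>below R J q. if l \<in> below R J p
        then direct_sum_inj (below R J p) (ob D) j (ar D i j x) l else \<zero>\<^bsub>ob D l\<^esub>)
      \<in> colimit_relations R (below R J q) D"
    unfolding extend_by_zero_inj[OF sub *(1)] extend_by_zero_inj[OF sub *(2)] colimit_relations_def
    using * by (intro subsetD[OF span_in_superset]) blast
qed (use assms in auto)

lemma left_kan_ar_linear:
  assumes "p \<in> P" "q \<in> P" "R p q"
  shows "ar (left_kan R J D) p q \<in> linear_maps (colimit R (below R J p) D) (colimit R (below R J q) D)"
proof -
  let ?V = "\<lambda>p. direct_sum (below R J p) (ob D)"
  have Z: "submodule (carrier (?V p)) scalars (?V p)" for p
    by (rule module.carrier_is_submodule[OF sum_module[OF below_subset]])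
  note lin = extend_by_zero_linear[OF below_subset below_mono[OF assms]]
  show ?thesis
    using induced_linear[OF sum_module[OF below_subset] relations_submodule[OF below_subset] Z
        sum_module[OF below_subset] relations_submodule[OF below_subset] Z lin
        extend_by_zero_relations[OF assms]] linear_mapsD(1)[OF lin]
    by (simp add: left_kan_def colimit_def image_subset_iff)
qed

lemma left_kan_ar_inj:
  assumes "p \<in> P" "q \<in> P" "R p q" "j \<in> below R J p" "x \<in> carrier (ob D j)"
  shows "ar (left_kan R J D) p q (colimit_inj (below R J p) j x) = colimit_inj (below R J q) j x"
  using induced_coset[OF sum_module[OF below_subset] relations_submodule[OF below_subset]
      sum_module[OF below_subset] relations_submodule[OF below_subset]
      extend_by_zero_linear[OF below_subset below_mono[OF assms(1-3)]]
      extend_by_zero_relations[OF assms(1-3)] sum_inj_closed[OF below_subset assms(4,5)]]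
  by (simp add: left_kan_def colimit_inj_def extend_by_zero_inj[OF below_mono[OF assms(1-3)] assms(4)])

text \<open>
  The family of all cocone sums to objects above \<open>p\<close> is the map on the direct sum from which the
  canonical map between the two Kan extensions descends.
\<close>

lemma cocone_sum_family_linear:
  assumes "p \<in> P"
  shows "(\<lambda>f. \<lambda>l\<in>above R J p. cocone_sum (below R J p) l f)
     \<in> linear_maps (direct_sum (below R J p) (ob D)) (direct_product (above R J p) (ob D))"
proof -
  have c: "cocone_sum (below R J p) l \<in> linear_maps (direct_sum (below R J p) (ob D)) (ob D l)"
    if "l \<in> above R J p" for l
    by (intro cocone_sum_linear below_subset aboveD(2)[OF that] below_above[OF assms _ that])
  show ?thesis
    using linear_mapsD[OF c]
    by (intro linear_mapsI) (auto intro!: ext simp: direct_product_def restrict_def)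
qed

lemma left_to_right_facts:
  assumes p: "p \<in> P"
  shows left_to_right_linear: "left_to_right R J D p
       \<in> linear_maps (colimit R (below R J p) D) (direct_product (above R J p) (ob D))"
    and left_to_right_inj: "j \<in> below R J p \<Longrightarrow> x \<in> carrier (ob D j) \<Longrightarrow>
       left_to_right R J D p (colimit_inj (below R J p) j x) = (\<lambda>l\<in>above R J p. ar D j l x)"
proof -
  let ?h = "\<lambda>f. \<lambda>l\<in>above R J p. cocone_sum (below R J p) l f"
  let ?U = "direct_product (above R J p) (ob D)"
  have eq: "left_to_right R J D p = (\<lambda>C. the_elem (?h ` C))"
    by (simp add: left_to_right_def cocone_sum_def fun_eq_iff)
  have U: "module scalars ?U"
    using aboveD ob_module by (intro direct_product_module) auto
  have "?h f = \<zero>\<^bsub>?U\<^esub>" if f: "f \<in> colimit_relations R (below R J p) D" for f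
  proof -
    have "cocone_sum (below R J p) l f = \<zero>\<^bsub>ob D l\<^esub>" if "l \<in> above R J p" for l
      using cocone_sum_relations[OF below_subset aboveD(2)[OF that] below_above[OF p _ that]] f
      by blast
    then show ?thesis
      by (auto simp: direct_product_def restrict_def)
  qed
  then have ker: "?h ` colimit_relations R (below R J p) D \<subseteq> {\<zero>\<^bsub>?U\<^esub>}" by blast
  note hyps = sum_module[OF below_subset] relations_submodule[OF below_subset] U
    cocone_sum_family_linear[OF p] ker
  show "left_to_right R J D p \<in> linear_maps (colimit R (below R J p) D) ?U"
    unfolding eq colimit_def by (rule descended_linear[OF hyps])
  assume jx: "j \<in> below R J p" "x \<in> carrier (ob D j)"
  have "left_to_right R J D p (colimit_inj (below R J p) j x)
      = ?h (direct_sum_inj (below R J p) (ob D) j x)"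
    unfolding eq colimit_inj_def
    by (rule descended_coset[OF hyps sum_inj_closed[OF below_subset jx]])
  also have "\<dots> = (\<lambda>l\<in>above R J p. ar D j l x)"
    by (intro restrict_ext cocone_sum_inj[OF below_subset aboveD(2) below_above[OF p] jx])
  finally show "left_to_right R J D p (colimit_inj (below R J p) j x)
      = (\<lambda>l\<in>above R J p. ar D j l x)" .
qed

text \<open>
  Two linear maps on the colimit are compared: the component at \<open>j\<close>, and the component at \<open>i\<close>
  followed by \<open>D(i \<rightarrow> j)\<close>. On the class of an element at \<open>q\<close> they agree by functoriality.
\<close>

lemma left_to_right_in_limit:
  assumes p: "p \<in> P" and C: "C \<in> carrier (colimit R (below R J p) D)"
  shows "left_to_right R J D p C \<in> carrier (limit R (above R J p) D)"
  unfolding limit_carrier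
proof (intro conjI ballI impI)
  note lin = left_to_right_linear[OF p]
  show "left_to_right R J D p C \<in> (\<Pi>\<^sub>E j\<in>above R J p. carrier (ob D j))"
    using linear_mapsD(1)[OF lin C] by (simp add: direct_product_def)
  fix i j assume ij: "i \<in> above R J p" "j \<in> above R J p" "R i j"
  note P = aboveD(2)[OF ij(1)] aboveD(2)[OF ij(2)]
  note comp = linear_maps_comp[OF lin proj_linear]
  show "ar D i j (left_to_right R J D p C i) = left_to_right R J D p C j"
  proof (rule colimit_linear_ext[OF below_subset ob_module
        linear_maps_comp[OF comp ar_linear] comp _ C])
    fix q x assume q: "q \<in> below R J p" "x \<in> carrier (ob D q)"
    then have "R q i" "q \<in> P" using below_above[OF p q(1) ij(1)] belowD(2) by auto
    then show "ar D i j (left_to_right R J D p (colimit_inj (below R J p) q x) i)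
       = left_to_right R J D p (colimit_inj (below R J p) q x) j"
      using left_to_right_inj[OF p q] ij P ar_comp q(2) by simp
  qed (use ij P in auto)
qed

end

end

section \<open>Interleavings through intermediate objects\<close>

lemma shift_mono: "x \<le> y \<Longrightarrow> shift X e x \<le> shift X e y"
  by (auto simp: shift_def)

text \<open>
  The combinatorial content of the net conditions. The step from \<open>(w, x)\<close> to \<open>(w, shift X e x)\<close>
  passes through the object \<open>\<sigma> x\<close> of the discrete subset \<open>J\<close>. Comparability of these objects
  ensures naturality of the maps built from \<open>\<sigma>\<close>.
\<close>

locale factoring_slice = transitive_diagram P R D
  for P R and D :: "(spacetime, 'k::field, 'a) diagram" +
  fixes J :: "spacetime set" and w :: "nat \<Rightarrow> real" and X :: "real set" and e :: real
    and \<sigma> :: "real \<Rightarrow> spacetime"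
  assumes J_subset: "J \<subseteq> P"
    and slice_in: "x \<in> X \<Longrightarrow> (w, x) \<in> P"
    and slice_mono: "x \<in> X \<Longrightarrow> y \<in> X \<Longrightarrow> x \<le> y \<Longrightarrow> R (w, x) (w, y)"
    and shift_in: "x \<in> X \<Longrightarrow> shift X e x \<in> X"
    and shift_ge: "x \<in> X \<Longrightarrow> x \<le> shift X e x"
    and shift_twice: "x \<in> X \<Longrightarrow> shift X e (shift X e x) = shift X (2 * e) x"
    and \<sigma>_in: "x \<in> X \<Longrightarrow> \<sigma> x \<in> J"
    and to_\<sigma>: "x \<in> X \<Longrightarrow> R (w, x) (\<sigma> x)"
    and from_\<sigma>: "x \<in> X \<Longrightarrow> R (\<sigma> x) (w, shift X e x)"
    and \<sigma>_comparable: "x \<in> X \<Longrightarrow> y \<in> X \<Longrightarrow> R (\<sigma> x) (\<sigma> y) \<or> R (\<sigma> y) (\<sigma> x)"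
begin

abbreviation "\<tau> \<equiv> shift X e"

lemma slice_simps [simp]: "ob (slice F w) x = ob F (w, x)" "ar (slice F w) x y = ar F (w, x) (w, y)"
  by (simp_all add: slice_def)

lemma precomp_simps [simp]:
  "ob (precomp U h) x = ob U (h x)" "ar (precomp U h) x y = ar U (h x) (h y)"
  by (simp_all add: precomp_def)

lemma left_kan_ob [simp]: "ob (left_kan R J D) p = colimit R (below R J p) D"
  by (simp add: left_kan_def)

lemma right_kan_simps [simp]:
  "ob (right_kan R J D) p = limit R (above R J p) D"
  "ar (right_kan R J D) p q f = restrict f (above R J q)"
  by (simp_all add: right_kan_def)

lemma \<sigma>_P: "x \<in> X \<Longrightarrow> \<sigma> x \<in> P"
  using \<sigma>_in J_subset by auto

lemma slice_shift: "x \<in> X \<Longrightarrow> R (w, x) (w, \<tau> x)"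
  by (simp add: slice_mono shift_in shift_ge)

lemma \<sigma>_below: "x \<in> X \<Longrightarrow> \<sigma> x \<in> below R J (w, \<tau> x)"
  using \<sigma>_in from_\<sigma> by (simp add: below_def)

text \<open>
  One map goes through \<open>D (\<sigma> x)\<close> into the colimit, the other one is the map out of the colimit given
  by the cocone. Equations that start in a colimit are verified on the classes of single elements.
\<close>

lemma interleaved_left: "interleaved X e (slice D w) (slice (left_kan R J D) w)"
proof -
  define \<Phi> where "\<Phi> x u = colimit_inj (below R J (w, \<tau> x)) (\<sigma> x) (ar D (w, x) (\<sigma> x) u)" for x u
  define \<Psi> where "\<Psi> x = from_colimit (below R J (w, x)) (w, \<tau> x)" for x
  note bs = below_subset[OF J_subset] and bD = belowD[OF J_subset] and bm = below_mono[OF J_subset]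
  have below_\<tau>: "R j (w, \<tau> x)" if "x \<in> X" "j \<in> below R J (w, x)" for j x
    using that R_trans[OF bD(2) slice_in slice_in bD(1) slice_shift] shift_in by blast
  have \<Phi>_linear: "\<Phi> x \<in> linear_maps (ob D (w, x)) (colimit R (below R J (w, \<tau> x)) D)"
    if x: "x \<in> X" for x
    using linear_maps_comp[OF ar_linear[OF slice_in \<sigma>_P to_\<sigma>] colimit_inj_linear[OF bs \<sigma>_below]] x
    by (simp add: \<Phi>_def[abs_def])
  have \<Psi>_linear: "\<Psi> x \<in> linear_maps (colimit R (below R J (w, x)) D) (ob D (w, \<tau> x))"
    if x: "x \<in> X" for x
    unfolding \<Psi>_def using x by (intro from_colimit_linear[OF bs] slice_in shift_in below_\<tau>)
  have \<Psi>_inj: "\<Psi> x (colimit_inj (below R J (w, x)) j a) = ar D j (w, \<tau> x) a"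
    if "x \<in> X" "j \<in> below R J (w, x)" "a \<in> carrier (ob D j)" for x j a
    unfolding \<Psi>_def using that by (intro from_colimit_inj[OF bs] slice_in shift_in below_\<tau>)
  have \<Phi>_natural: "\<Phi> y (ar D (w, x) (w, y) u) = ar (left_kan R J D) (w, \<tau> x) (w, \<tau> y) (\<Phi> x u)"
    if x: "x \<in> X" and y: "y \<in> X" and xy: "x \<le> y" and u: "u \<in> carrier (ob D (w, x))" for x y u
  proof -
    let ?K = "below R J (w, \<tau> y)"
    have R: "R (w, x) (w, y)" "R (w, \<tau> x) (w, \<tau> y)" "R (w, x) (\<sigma> y)"
      using slice_mono[OF x y xy] slice_mono[OF shift_in[OF x] shift_in[OF y] shift_mono[OF xy]]
        R_trans[OF slice_in[OF x] slice_in[OF y] \<sigma>_P[OF y] _ to_\<sigma>[OF y]] by blast+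
    have K: "\<sigma> x \<in> ?K" "\<sigma> y \<in> ?K"
      using \<sigma>_below[OF x] \<sigma>_below[OF y]
        bm[OF slice_in[OF shift_in[OF x]] slice_in[OF shift_in[OF y]] R(2)] by blast+
    have a: "ar D (w, x) (\<sigma> x) u \<in> carrier (ob D (\<sigma> x))" "ar D (w, x) (\<sigma> y) u \<in> carrier (ob D (\<sigma> y))"
      using ar_closed[OF slice_in[OF x] \<sigma>_P[OF x] to_\<sigma>[OF x] u]
        ar_closed[OF slice_in[OF x] \<sigma>_P[OF y] R(3) u] by blast+
    have "\<Phi> y (ar D (w, x) (w, y) u) = colimit_inj ?K (\<sigma> y) (ar D (w, x) (\<sigma> y) u)"
      using ar_comp[OF slice_in slice_in \<sigma>_P R(1) to_\<sigma> u] x y by (simp add: \<Phi>_def)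
    \<comment> \<open>Both intermediate objects lie below \<open>(w, \<tau> y)\<close>, so their comparison is a relation of the
      colimit there.\<close>
    also have "\<dots> = colimit_inj ?K (\<sigma> x) (ar D (w, x) (\<sigma> x) u)"
      using \<sigma>_comparable[OF x y]
    proof
      assume r: "R (\<sigma> x) (\<sigma> y)"
      then show ?thesis
        using colimit_inj_compat[OF bs K r a(1)] ar_comp[OF slice_in \<sigma>_P \<sigma>_P to_\<sigma> r u] x y by simp
    next
      assume r: "R (\<sigma> y) (\<sigma> x)"
      then show ?thesis
        using colimit_inj_compat[OF bs K(2,1) r a(2)] ar_comp[OF slice_in \<sigma>_P \<sigma>_P R(3) r u] x y
        by simp
    qed
    also have "\<dots> = ar (left_kan R J D) (w, \<tau> x) (w, \<tau> y) (\<Phi> x u)"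
      using left_kan_ar_inj[OF J_subset slice_in slice_in R(2) \<sigma>_below a(1)] x y shift_in
      by (simp add: \<Phi>_def)
    finally show ?thesis .
  qed
  have \<Psi>_natural: "\<Psi> y (ar (left_kan R J D) (w, x) (w, y) C) = ar D (w, \<tau> x) (w, \<tau> y) (\<Psi> x C)"
    if x: "x \<in> X" and y: "y \<in> X" and xy: "x \<le> y"
      and C: "C \<in> carrier (colimit R (below R J (w, x)) D)" for x y C
  proof -
    have P: "(w, x) \<in> P" "(w, y) \<in> P" "(w, \<tau> x) \<in> P" "(w, \<tau> y) \<in> P"
      using x y slice_in shift_in by auto
    have R: "R (w, x) (w, y)" "R (w, \<tau> x) (w, \<tau> y)"
      using slice_mono[OF x y xy] slice_mono[OF shift_in[OF x] shift_in[OF y] shift_mono[OF xy]]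
      by blast+
    show ?thesis
    proof (rule colimit_linear_ext[OF bs ob_module[OF P(4)]
          linear_maps_comp[OF left_kan_ar_linear[OF J_subset P(1,2) R(1)] \<Psi>_linear[OF y]]
          linear_maps_comp[OF \<Psi>_linear[OF x] ar_linear[OF P(3,4) R(2)]] _ C])
      fix j a assume j: "j \<in> below R J (w, x)" and a: "a \<in> carrier (ob D j)"
      then have "j \<in> below R J (w, y)" using bm[OF P(1,2) R(1)] by blast
      then show "\<Psi> y (ar (left_kan R J D) (w, x) (w, y) (colimit_inj (below R J (w, x)) j a))
          = ar D (w, \<tau> x) (w, \<tau> y) (\<Psi> x (colimit_inj (below R J (w, x)) j a))"
        using left_kan_ar_inj[OF J_subset P(1,2) R(1) j a] \<Psi>_inj[OF y _ a] \<Psi>_inj[OF x j a]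
          ar_comp[OF bD(2)[OF j] P(3,4) below_\<tau>[OF x j] R(2) a] by simp
    qed
  qed
  have \<Psi>\<Phi>: "\<Psi> (\<tau> x) (\<Phi> x u) = ar D (w, x) (w, shift X (2 * e) x) u"
    if x: "x \<in> X" and u: "u \<in> carrier (ob D (w, x))" for x u
  proof -
    have P: "(w, x) \<in> P" "\<sigma> x \<in> P" "(w, \<tau> (\<tau> x)) \<in> P"
      using x slice_in shift_in \<sigma>_P by auto
    have "ar D (w, x) (\<sigma> x) u \<in> carrier (ob D (\<sigma> x))"
      using x u ar_closed P to_\<sigma> by blast
    then have "\<Psi> (\<tau> x) (\<Phi> x u) = ar D (\<sigma> x) (w, \<tau> (\<tau> x)) (ar D (w, x) (\<sigma> x) u)"
      using \<Psi>_inj[OF shift_in[OF x] \<sigma>_below[OF x]] by (simp add: \<Phi>_def)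
    also have "\<dots> = ar D (w, x) (w, \<tau> (\<tau> x)) u"
      using ar_comp[OF P to_\<sigma>[OF x] below_\<tau>[OF shift_in[OF x] \<sigma>_below[OF x]] u] .
    finally show ?thesis using shift_twice[OF x] by simp
  qed
  have \<Phi>\<Psi>: "\<Phi> (\<tau> x) (\<Psi> x C) = ar (left_kan R J D) (w, x) (w, shift X (2 * e) x) C"
    if x: "x \<in> X" and C: "C \<in> carrier (colimit R (below R J (w, x)) D)" for x C
  proof -
    let ?K = "below R J (w, \<tau> (\<tau> x))"
    have \<tau>x: "\<tau> x \<in> X" "\<tau> (\<tau> x) \<in> X" using x shift_in by auto
    have P: "(w, x) \<in> P" "(w, \<tau> x) \<in> P" "(w, \<tau> (\<tau> x)) \<in> P" "\<sigma> (\<tau> x) \<in> P"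
      using x \<tau>x slice_in \<sigma>_P by auto
    have R: "R (w, x) (w, \<tau> (\<tau> x))"
      by (rule R_trans[OF P(1,2,3) slice_shift[OF x] slice_shift[OF \<tau>x(1)]])
    have "\<Phi> (\<tau> x) (\<Psi> x C) = ar (left_kan R J D) (w, x) (w, \<tau> (\<tau> x)) C"
    proof (rule colimit_linear_ext[OF bs colimit_module[OF bs]
          linear_maps_comp[OF \<Psi>_linear[OF x] \<Phi>_linear[OF \<tau>x(1)]]
          left_kan_ar_linear[OF J_subset P(1,3) R] _ C])
      fix j a assume j: "j \<in> below R J (w, x)" and a: "a \<in> carrier (ob D j)"
      have jP: "j \<in> P" and jK: "j \<in> ?K" using j bD bm[OF P(1,3) R] by blast+
      have j\<sigma>: "R j (\<sigma> (\<tau> x))"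
        by (rule R_trans[OF jP P(2,4) below_\<tau>[OF x j] to_\<sigma>[OF \<tau>x(1)]])
      have "\<Phi> (\<tau> x) (\<Psi> x (colimit_inj (below R J (w, x)) j a))
          = colimit_inj ?K (\<sigma> (\<tau> x)) (ar D j (\<sigma> (\<tau> x)) a)"
        using \<Psi>_inj[OF x j a] ar_comp[OF jP P(2,4) below_\<tau>[OF x j] to_\<sigma>[OF \<tau>x(1)] a]
        by (simp add: \<Phi>_def)
      \<comment> \<open>Here \<open>j \<le> (w, \<tau> x) \<le> \<sigma> (\<tau> x)\<close>, and both ends belong to the indexing set at
        \<open>(w, \<tau> (\<tau> x))\<close>.\<close>
      also have "\<dots> = colimit_inj ?K j a"
        using colimit_inj_compat[OF bs jK \<sigma>_below[OF \<tau>x(1)] j\<sigma> a] .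
      also have "\<dots> = ar (left_kan R J D) (w, x) (w, \<tau> (\<tau> x)) (colimit_inj (below R J (w, x)) j a)"
        using left_kan_ar_inj[OF J_subset P(1,3) R j a] by simp
      finally show "\<Phi> (\<tau> x) (\<Psi> x (colimit_inj (below R J (w, x)) j a))
          = ar (left_kan R J D) (w, x) (w, \<tau> (\<tau> x)) (colimit_inj (below R J (w, x)) j a)" .
    qed
    then show ?thesis using shift_twice[OF x] by simp
  qed
  have "\<Phi> \<in> nat_trans X (slice D w) (precomp (slice (left_kan R J D) w) \<tau>)"
    using \<Phi>_linear \<Phi>_natural by (simp add: nat_trans_def)
  moreover have "\<Psi> \<in> nat_trans X (slice (left_kan R J D) w) (precomp (slice D w) \<tau>)"
    using \<Psi>_linear \<Psi>_natural by (simp add: nat_trans_def)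
  ultimately show ?thesis
    unfolding interleaved_def using \<Psi>\<Phi> \<Phi>\<Psi> by (intro bexI[of _ \<Phi>] bexI[of _ \<Psi>]) simp_all
qed

text \<open>
  The dual pair of maps, for the right Kan extension. They also serve the center extension, whose
  objects are subspaces of limits and whose maps are restrictions as well.
\<close>

definition to_limit :: "real \<Rightarrow> 'a \<Rightarrow> spacetime \<Rightarrow> 'a" where
  "to_limit x u = (\<lambda>l\<in>above R J (w, \<tau> x). ar D (w, x) l u)"

definition from_limit :: "real \<Rightarrow> (spacetime \<Rightarrow> 'a) \<Rightarrow> 'a" where
  "from_limit x f = ar D (\<sigma> x) (w, \<tau> x) (f (\<sigma> x))"

lemma \<sigma>_above: "x \<in> X \<Longrightarrow> \<sigma> x \<in> above R J (w, x)"
  using \<sigma>_in to_\<sigma> by (simp add: above_def)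

lemma above_\<tau>: "x \<in> X \<Longrightarrow> l \<in> above R J (w, \<tau> x) \<Longrightarrow> R (w, x) l"
  using R_trans[OF slice_in slice_in aboveD(2)[OF J_subset] slice_shift aboveD(1)[OF J_subset]] shift_in
  by blast

lemma to_limit_in_limit:
  assumes x: "x \<in> X" and u: "u \<in> carrier (ob D (w, x))"
  shows "to_limit x u \<in> carrier (limit R (above R J (w, \<tau> x)) D)"
  unfolding limit_carrier to_limit_def
  using above_\<tau>[OF x] aboveD(2)[OF J_subset] ar_closed[OF slice_in[OF x] _ _ u]
    ar_comp[OF slice_in[OF x] _ _ _ _ u] by simp

lemma to_limit_linear:
  assumes x: "x \<in> X"
  shows "to_limit x \<in> linear_maps (ob D (w, x)) (limit R (above R J (w, \<tau> x)) D)"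
proof -
  have "ar D (w, x) l \<in> linear_maps (ob D (w, x)) (ob D l)" if "l \<in> above R J (w, \<tau> x)" for l
    by (rule ar_linear[OF slice_in[OF x] aboveD(2)[OF J_subset that] above_\<tau>[OF x that]])
  note lin = linear_mapsD(2,3)[OF this]
  show ?thesis
    using lin to_limit_in_limit[OF x]
    by (intro linear_mapsI) (auto intro!: ext simp: to_limit_def limit_def direct_product_def)
qed

lemma from_limit_linear:
  assumes x: "x \<in> X"
  shows "from_limit x \<in> linear_maps (limit R (above R J (w, x)) D) (ob D (w, \<tau> x))"
proof -
  have "(\<lambda>f. f (\<sigma> x)) \<in> linear_maps (limit R (above R J (w, x)) D) (ob D (\<sigma> x))"
    using \<sigma>_above[OF x] by (intro linear_mapsI) (auto simp: limit_def direct_product_def)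
  from linear_maps_comp[OF this ar_linear[OF \<sigma>_P[OF x] slice_in[OF shift_in[OF x]] from_\<sigma>[OF x]]]
  show ?thesis by (simp add: from_limit_def[abs_def])
qed

lemma to_limit_natural:
  assumes x: "x \<in> X" and y: "y \<in> X" and xy: "x \<le> y" and u: "u \<in> carrier (ob D (w, x))"
  shows "to_limit y (ar D (w, x) (w, y) u) = restrict (to_limit x u) (above R J (w, \<tau> y))"
proof -
  have "above R J (w, \<tau> y) \<subseteq> above R J (w, \<tau> x)"
    by (intro above_mono J_subset slice_in slice_mono shift_in shift_mono x y xy)
  moreover have "ar D (w, y) l (ar D (w, x) (w, y) u) = ar D (w, x) l u"
    if "l \<in> above R J (w, \<tau> y)" for l
    by (rule ar_comp[OF slice_in[OF x] slice_in[OF y] aboveD(2)[OF J_subset that]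
        slice_mono[OF x y xy] above_\<tau>[OF y that] u])
  ultimately show ?thesis
    by (intro ext) (auto simp: to_limit_def restrict_def)
qed

text \<open>
  If \<open>\<sigma> x\<close> and \<open>\<sigma> y\<close> are comparable, the values of a compatible family at them determine the same
  element at \<open>(w, \<tau> y)\<close>.
\<close>

lemma from_limit_natural:
  assumes x: "x \<in> X" and y: "y \<in> X" and xy: "x \<le> y"
    and f: "f \<in> carrier (limit R (above R J (w, x)) D)"
  shows "from_limit y (restrict f (above R J (w, y))) = ar D (w, \<tau> x) (w, \<tau> y) (from_limit x f)"
proof -
  have P: "(w, x) \<in> P" "(w, y) \<in> P" "(w, \<tau> x) \<in> P" "(w, \<tau> y) \<in> P" "\<sigma> x \<in> P" "\<sigma> y \<in> P"
    using x y slice_in shift_in \<sigma>_P by auto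
  have Rxy: "R (w, x) (w, y)" and R\<tau>: "R (w, \<tau> x) (w, \<tau> y)"
    by (intro slice_mono shift_in shift_mono x y xy)+
  have "above R J (w, y) \<subseteq> above R J (w, x)" by (rule above_mono[OF J_subset P(1,2) Rxy])
  then have \<sigma>: "\<sigma> x \<in> above R J (w, x)" "\<sigma> y \<in> above R J (w, x)"
    using \<sigma>_above x y by auto
  then have val: "f (\<sigma> x) \<in> carrier (ob D (\<sigma> x))" "f (\<sigma> y) \<in> carrier (ob D (\<sigma> y))"
    using f by (auto simp: limit_carrier)
  have compat: "R i j \<Longrightarrow> ar D i j (f i) = f j"
    if "i \<in> above R J (w, x)" "j \<in> above R J (w, x)" for i j
    using f that by (simp add: limit_carrier)
  have R\<sigma>: "R (\<sigma> x) (w, \<tau> y)"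
    by (rule R_trans[OF P(5,3,4) from_\<sigma>[OF x] R\<tau>])
  have "ar D (\<sigma> y) (w, \<tau> y) (f (\<sigma> y)) = ar D (\<sigma> x) (w, \<tau> y) (f (\<sigma> x))"
    using \<sigma>_comparable[OF x y]
  proof
    assume r: "R (\<sigma> x) (\<sigma> y)"
    show ?thesis
      using ar_comp[OF P(5,6,4) r from_\<sigma>[OF y] val(1)] compat[OF \<sigma> r] by simp
  next
    assume r: "R (\<sigma> y) (\<sigma> x)"
    show ?thesis
      using ar_comp[OF P(6,5,4) r R\<sigma> val(2)] compat[OF \<sigma>(2,1) r] by simp
  qed
  also have "\<dots> = ar D (w, \<tau> x) (w, \<tau> y) (from_limit x f)"
    using ar_comp[OF P(5,3,4) from_\<sigma>[OF x] R\<tau> val(1)] by (simp add: from_limit_def)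
  finally show ?thesis
    using \<sigma>_above[OF y] by (simp add: from_limit_def)
qed

lemma from_limit_to_limit:
  assumes x: "x \<in> X" and u: "u \<in> carrier (ob D (w, x))"
  shows "from_limit (\<tau> x) (to_limit x u) = ar D (w, x) (w, shift X (2 * e) x) u"
proof -
  note \<tau>x = shift_in[OF x]
  have "from_limit (\<tau> x) (to_limit x u)
      = ar D (\<sigma> (\<tau> x)) (w, \<tau> (\<tau> x)) (ar D (w, x) (\<sigma> (\<tau> x)) u)"
    using \<sigma>_above[OF \<tau>x] by (simp add: from_limit_def to_limit_def)
  also have "\<dots> = ar D (w, x) (w, \<tau> (\<tau> x)) u"
    by (rule ar_comp[OF slice_in[OF x] \<sigma>_P[OF \<tau>x] slice_in[OF shift_in[OF \<tau>x]]
          above_\<tau>[OF x \<sigma>_above[OF \<tau>x]] from_\<sigma>[OF \<tau>x] u])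
  finally show ?thesis using shift_twice[OF x] by simp
qed

lemma to_limit_from_limit:
  assumes x: "x \<in> X" and f: "f \<in> carrier (limit R (above R J (w, x)) D)"
  shows "to_limit (\<tau> x) (from_limit x f) = restrict f (above R J (w, shift X (2 * e) x))"
proof -
  note \<tau>x = shift_in[OF x]
  have P: "(w, x) \<in> P" "(w, \<tau> x) \<in> P" "(w, \<tau> (\<tau> x)) \<in> P" "\<sigma> x \<in> P"
    using x \<tau>x slice_in shift_in \<sigma>_P by auto
  have "ar D (w, \<tau> x) l (from_limit x f) = f l" if l: "l \<in> above R J (w, \<tau> (\<tau> x))" for l
  proof -
    have lP: "l \<in> P" and R\<tau>l: "R (w, \<tau> x) l"
      using aboveD(2)[OF J_subset l] above_\<tau>[OF \<tau>x l] by auto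
    have lx: "l \<in> above R J (w, x)"
      using l R_trans[OF P(1,2) lP slice_shift[OF x] R\<tau>l] by (simp add: above_def)
    have val: "f (\<sigma> x) \<in> carrier (ob D (\<sigma> x))"
      using f \<sigma>_above[OF x] by (auto simp: limit_carrier)
    have "ar D (w, \<tau> x) l (from_limit x f) = ar D (\<sigma> x) l (f (\<sigma> x))"
      using ar_comp[OF P(4,2) lP from_\<sigma>[OF x] R\<tau>l val] by (simp add: from_limit_def)
    also have "\<dots> = f l"
      using f \<sigma>_above[OF x] lx R_trans[OF P(4,2) lP from_\<sigma>[OF x] R\<tau>l] by (simp add: limit_carrier)
    finally show ?thesis .
  qed
  then show ?thesis
    using shift_twice[OF x] by (auto simp: to_limit_def)
qed

lemma interleaved_right: "interleaved X e (slice D w) (slice (right_kan R J D) w)"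
proof -
  have "to_limit \<in> nat_trans X (slice D w) (precomp (slice (right_kan R J D) w) \<tau>)"
    using to_limit_linear to_limit_natural by (simp add: nat_trans_def)
  moreover have "from_limit \<in> nat_trans X (slice (right_kan R J D) w) (precomp (slice D w) \<tau>)"
    using from_limit_linear from_limit_natural by (simp add: nat_trans_def)
  ultimately show ?thesis
    unfolding interleaved_def using from_limit_to_limit to_limit_from_limit
    by (intro bexI[of _ to_limit] bexI[of _ from_limit]) simp_all
qed

lemma center_kan_simps [simp]:
  "ob (center_kan R J D) p
     = (limit R (above R J p) D)\<lparr>carrier := left_to_right R J D p ` carrier (colimit R (below R J p) D)\<rparr>"
  "ar (center_kan R J D) p q f = restrict f (above R J q)"
  by (simp_all add: center_kan_def)

text \<open>
  The map into the limit passes through \<open>D (\<sigma> x)\<close>, so the family of images of \<open>u\<close> is the image under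
  the canonical map of the class of the image of \<open>u\<close> at \<open>\<sigma> x\<close>.
\<close>

lemma to_limit_in_center:
  assumes x: "x \<in> X" and u: "u \<in> carrier (ob D (w, x))"
  shows "to_limit x u \<in> carrier (ob (center_kan R J D) (w, \<tau> x))"
proof -
  let ?a = "ar D (w, x) (\<sigma> x) u"
  note P = slice_in[OF x] \<sigma>_P[OF x] slice_in[OF shift_in[OF x]]
  have a: "?a \<in> carrier (ob D (\<sigma> x))" by (rule ar_closed[OF P(1,2) to_\<sigma>[OF x] u])
  have "ar D (\<sigma> x) l ?a = ar D (w, x) l u" if l: "l \<in> above R J (w, \<tau> x)" for l
    using aboveD[OF J_subset l] R_trans[OF P(2,3) _ from_\<sigma>[OF x]]
    by (intro ar_comp[OF P(1,2) _ to_\<sigma>[OF x] _ u]) auto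
  then have "to_limit x u
      = left_to_right R J D (w, \<tau> x) (colimit_inj (below R J (w, \<tau> x)) (\<sigma> x) ?a)"
    unfolding left_to_right_inj[OF J_subset P(3) \<sigma>_below[OF x] a] to_limit_def
    by (intro restrict_ext) simp
  moreover have "colimit_inj (below R J (w, \<tau> x)) (\<sigma> x) ?a
      \<in> carrier (colimit R (below R J (w, \<tau> x)) D)"
    by (rule linear_mapsD(1)[OF colimit_inj_linear[OF below_subset[OF J_subset] \<sigma>_below[OF x]] a])
  ultimately show ?thesis by simp
qed

lemma center_in_limit:
  assumes "x \<in> X" and "f \<in> carrier (ob (center_kan R J D) (w, x))"
  shows "f \<in> carrier (limit R (above R J (w, x)) D)"
  using assms left_to_right_in_limit[OF J_subset slice_in] by auto

lemma interleaved_center: "interleaved X e (slice D w) (slice (center_kan R J D) w)"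
proof -
  have "to_limit x \<in> linear_maps (ob D (w, x)) (ob (center_kan R J D) (w, \<tau> x))" if x: "x \<in> X" for x
    using linear_mapsD[OF to_limit_linear[OF x]] to_limit_in_center[OF x]
    by (intro linear_mapsI) auto
  then have "to_limit \<in> nat_trans X (slice D w) (precomp (slice (center_kan R J D) w) \<tau>)"
    using to_limit_natural by (simp add: nat_trans_def)
  moreover have "from_limit x \<in> linear_maps (ob (center_kan R J D) (w, x)) (ob D (w, \<tau> x))"
    if x: "x \<in> X" for x
    using linear_mapsD[OF from_limit_linear[OF x] center_in_limit[OF x]] center_in_limit[OF x]
    by (intro linear_mapsI) auto
  then have "from_limit \<in> nat_trans X (slice (center_kan R J D) w) (precomp (slice D w) \<tau>)"
    using from_limit_natural center_in_limit by (simp add: nat_trans_def)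
  ultimately show ?thesis
    unfolding interleaved_def using from_limit_to_limit to_limit_from_limit center_in_limit
    by (intro bexI[of _ to_limit] bexI[of _ from_limit]) simp_all
qed

end

section \<open>Singular homology of subspaces\<close>

lemma chain_space_simps [simp]:
  "carrier (chain_space p X) = {c. Poly_Mapping.keys c \<subseteq> singular_simplex_set p X}"
  "\<zero>\<^bsub>chain_space p X\<^esub> = 0"
  "c \<oplus>\<^bsub>chain_space p X\<^esub> c' = c + c'"
  "a \<odot>\<^bsub>chain_space p X\<^esub> c = Poly_Mapping.map ((*) a) c"
  by (simp_all add: chain_space_def)

lemma lookup_scale: "Poly_Mapping.lookup (Poly_Mapping.map ((*) a) c) f = a * Poly_Mapping.lookup c f"
  for a :: "'k::field"
  by (simp add: Poly_Mapping.map.rep_eq when_def)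

lemma keys_scale: "Poly_Mapping.keys (Poly_Mapping.map ((*) a) c) \<subseteq> Poly_Mapping.keys c"
  for a :: "'k::field"
  by (auto simp: lookup_scale in_keys_iff)

lemma chain_space_module: "module scalars (chain_space p X :: ('k::field, ('k, 'x) kchain) module)"
proof (rule moduleI[OF cring_scalars])
  show "abelian_group (chain_space p X :: ('k, ('k, 'x) kchain) module)"
  proof (rule abelian_groupI)
    fix c :: "('k, 'x) kchain" assume "c \<in> carrier (chain_space p X)"
    then show "\<exists>c'\<in>carrier (chain_space p X). c' \<oplus>\<^bsub>chain_space p X\<^esub> c = \<zero>\<^bsub>chain_space p X\<^esub>"
      by (intro bexI[of _ "- c"]) (auto simp: in_keys_iff)
  next
    fix c c' :: "('k, 'x) kchain"
    assume "c \<in> carrier (chain_space p X)" "c' \<in> carrier (chain_space p X)"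
    then show "c \<oplus>\<^bsub>chain_space p X\<^esub> c' \<in> carrier (chain_space p X)"
      using Poly_Mapping.keys_add[of c c'] by auto
  qed (auto simp: algebra_simps)
next
  fix a and c :: "('k, 'x) kchain" assume "c \<in> carrier (chain_space p X)"
  then show "a \<odot>\<^bsub>chain_space p X\<^esub> c \<in> carrier (chain_space p X)"
    using keys_scale[of a c] by auto
qed (auto intro!: poly_mapping_eqI simp: lookup_scale lookup_add algebra_simps)

lemma chain_space_sum_closed:
  fixes g :: "'i \<Rightarrow> ('k::field, 'x) kchain"
  assumes "\<And>i. i \<in> I \<Longrightarrow> g i \<in> carrier (chain_space p X)"
  shows "sum g I \<in> carrier (chain_space p X)"
  using assms keys_sum[of g I] by fastforce

text \<open>
  Additivity of the boundary requires the sums for different chains to run over a common set of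
  simplices.
\<close>

lemma boundary_map_superset:
  assumes "finite S" "Poly_Mapping.keys c \<subseteq> S" "p \<noteq> 0"
  shows "boundary_map p c = (\<Sum>f\<in>S. \<Sum>i\<le>p.
    Poly_Mapping.single (singular_face p i f) ((-1) ^ i * Poly_Mapping.lookup c f))"
  using assms by (auto simp: boundary_map_def in_keys_iff intro!: sum.mono_neutral_left)

lemma boundary_map_linear:
  "boundary_map p \<in> linear_maps (chain_space p X) (chain_space (p - 1) X :: ('k::field, ('k, 'x) kchain) module)"
proof (cases "p = 0")
  case True
  then show ?thesis
    by (intro linear_mapsI) (auto simp: boundary_map_def intro!: poly_mapping_eqI simp: lookup_scale)
next
  case False
  show ?thesis
  proof (rule linear_mapsI)
    fix c c' :: "('k, 'x) kchain"
    let ?d = "\<lambda>f i a. Poly_Mapping.single (singular_face p i f) ((-1) ^ i * a)"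
    assume c: "c \<in> carrier (chain_space p X)"
    have face: "?d f i a \<in> carrier (chain_space (p - 1) X)"
      if "f \<in> Poly_Mapping.keys c" "i \<le> p" for f i and a :: 'k
      using that c False singular_simplex_singular_face[of p X f i] by (auto simp: subset_iff)
    show "boundary_map p c \<in> carrier (chain_space (p - 1) X)"
      unfolding boundary_map_def if_not_P[OF False] by (intro chain_space_sum_closed face) auto
    let ?S = "Poly_Mapping.keys c \<union> Poly_Mapping.keys c'"
    have S: "finite ?S" by simp
    have "boundary_map p (c + c') = (\<Sum>f\<in>?S. \<Sum>i\<le>p. ?d f i (Poly_Mapping.lookup (c + c') f))"
      by (rule boundary_map_superset[OF S Poly_Mapping.keys_add False])
    also have "\<dots> = (\<Sum>f\<in>?S. \<Sum>i\<le>p. ?d f i (Poly_Mapping.lookup c f))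
        + (\<Sum>f\<in>?S. \<Sum>i\<le>p. ?d f i (Poly_Mapping.lookup c' f))"
      by (simp add: lookup_add distrib_left single_add sum.distrib)
    also have "\<dots> = boundary_map p c + boundary_map p c'"
      using boundary_map_superset[OF S _ False, of c] boundary_map_superset[OF S _ False, of c'] by simp
    finally show "boundary_map p (c \<oplus>\<^bsub>chain_space p X\<^esub> c')
        = boundary_map p c \<oplus>\<^bsub>chain_space (p - 1) X\<^esub> boundary_map p c'" by simp
    show "boundary_map p (a \<odot>\<^bsub>chain_space p X\<^esub> c) = a \<odot>\<^bsub>chain_space (p - 1) X\<^esub> boundary_map p c" for a
    proof -
      have "boundary_map p (Poly_Mapping.map ((*) a) c)
          = (\<Sum>f\<in>Poly_Mapping.keys c. \<Sum>i\<le>p. ?d f i (a * Poly_Mapping.lookup c f))"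
        using boundary_map_superset[OF _ keys_scale False, of c a] by (simp add: lookup_scale)
      also have "\<dots> = Poly_Mapping.map ((*) a) (boundary_map p c)"
        using False
        by (intro poly_mapping_eqI)
          (auto simp: boundary_map_def lookup_scale lookup_sum lookup_single sum_distrib_left when_def
            intro!: sum.cong)
      finally show ?thesis by simp
    qed
  qed
qed

lemma cycles_submodule:
  "submodule (cycles p X) scalars (chain_space p X :: ('k::field, ('k, 'x) kchain) module)"
proof -
  let ?V = "chain_space (p - 1) X :: ('k, ('k, 'x) kchain) module"
  have eq: "cycles p X = {c \<in> carrier (chain_space p X). boundary_map p c \<in> {\<zero>\<^bsub>?V\<^esub>}}"
    by (auto simp: cycles_def)
  show ?thesis
    unfolding eq
    by (rule submodule_preimage[OF chain_space_module chain_space_module boundary_map_linear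
          submodule_zero[OF chain_space_module]])
qed

lemma boundaries_submodule:
  "submodule (boundaries p X) scalars (chain_space p X :: ('k::field, ('k, 'x) kchain) module)"
proof -
  have lin: "boundary_map (Suc p) \<in> linear_maps (chain_space (Suc p) X)
      (chain_space p X :: ('k, ('k, 'x) kchain) module)"
    using boundary_map_linear[of "Suc p" X] by simp
  show ?thesis
    unfolding boundaries_def
    by (rule submodule_image[OF chain_space_module chain_space_module lin
          module.carrier_is_submodule[OF chain_space_module]])
qed

lemma homology_module: "module scalars (homology TYPE('k::field) p X)"
  unfolding homology_def
  by (rule quotient_space_module[OF chain_space_module boundaries_submodule cycles_submodule])

context
  fixes T :: "'x topology" and S S' :: "'x set"
  assumes sub: "S \<subseteq> S'"
begin

lemma chain_space_mono:
  "carrier (chain_space p (subtopology T S)) \<subseteq> carrier (chain_space p (subtopology T S'))"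
proof -
  have "singular_simplex_set p (subtopology T S) \<subseteq> singular_simplex_set p (subtopology T S')"
    using sub unfolding singular_simplex_subtopology by blast
  then show ?thesis by auto
qed

lemma chain_inclusion_linear:
  "id \<in> linear_maps (chain_space p (subtopology T S))
     (chain_space p (subtopology T S') :: ('k::field, ('k, 'x) kchain) module)"
  using chain_space_mono[of p] by (intro linear_mapsI) auto

lemma boundaries_mono:
  "id ` (boundaries p (subtopology T S) :: ('k::field, 'x) kchain set) \<subseteq> boundaries p (subtopology T S')"
  unfolding boundaries_def using image_mono[OF chain_space_mono] by simp

lemma cycles_mono:
  "id ` (cycles p (subtopology T S) :: ('k::field, 'x) kchain set) \<subseteq> cycles p (subtopology T S')"
  using chain_space_mono[of p] by (auto simp: cycles_def)

lemma homology_incl_linear: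
  "homology_incl p (subtopology T S') \<in> linear_maps (homology TYPE('k::field) p (subtopology T S))
     (homology TYPE('k) p (subtopology T S'))"
  using induced_linear[OF chain_space_module boundaries_submodule cycles_submodule
      chain_space_module boundaries_submodule cycles_submodule
      chain_inclusion_linear boundaries_mono cycles_mono]
  by (simp add: homology_def homology_incl_def[abs_def])

lemma homology_incl_class:
  fixes z :: "('k::field, 'x) kchain"
  assumes "z \<in> carrier (chain_space p (subtopology T S))"
  shows "homology_incl p (subtopology T S')
     (boundaries p (subtopology T S) +>\<^bsub>chain_space p (subtopology T S)\<^esub> z)
     = boundaries p (subtopology T S') +>\<^bsub>chain_space p (subtopology T S')\<^esub> z"
  using induced_coset[OF chain_space_module boundaries_submodule chain_space_module
      boundaries_submodule chain_inclusion_linear boundaries_mono assms]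
  by (simp add: homology_incl_def)

end

text \<open>
  Every class of cycles is sent to the class of the same chain, so inclusions compose.
\<close>

lemma homology_incl_comp:
  assumes sub: "S \<subseteq> S'" "S' \<subseteq> S''"
    and C: "C \<in> carrier (homology TYPE('k::field) p (subtopology T S))"
  shows "homology_incl p (subtopology T S'') (homology_incl p (subtopology T S') C)
    = homology_incl p (subtopology T S'') C"
proof -
  obtain z where "z \<in> cycles p (subtopology T S)"
    and C: "C = boundaries p (subtopology T S) +>\<^bsub>chain_space p (subtopology T S)\<^esub> z"
    using C unfolding homology_def quotient_carrier[OF chain_space_module boundaries_submodule]
    by blast
  then have "z \<in> carrier (chain_space p (subtopology T S))"
    "z \<in> carrier (chain_space p (subtopology T S'))"
    using chain_space_mono[OF sub(1), of p T] by (auto simp: cycles_def)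
  then show ?thesis
    using sub unfolding C by (simp add: homology_incl_class)
qed

section \<open>Geometry of space-time\<close>

lemma inner_prod_commute: "inner_prod d x y = inner_prod d y x"
  by (simp add: inner_prod_def mult.commute)

lemma inner_prod_self: "inner_prod d x x = (L2_set x {..<d})\<^sup>2"
  by (simp add: inner_prod_def L2_set_def power2_eq_square[symmetric] sum_nonneg)

lemma inner_prod_Cauchy_Schwarz: "\<bar>inner_prod d x y\<bar> \<le> L2_set x {..<d} * L2_set y {..<d}"
proof -
  have "\<bar>inner_prod d x y\<bar> \<le> (\<Sum>i<d. \<bar>x i\<bar> * \<bar>y i\<bar>)"
    unfolding inner_prod_def using sum_abs[of "\<lambda>i. x i * y i" "{..<d}"] by (simp add: abs_mult)
  then show ?thesis
    using L2_set_mult_ineq[of x y "{..<d}"] by linarith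
qed

lemma unit_sphereD: "v \<in> unit_sphere d \<Longrightarrow> L2_set v {..<d} = 1"
  by (simp add: unit_sphere_def)

lemma unit_ballD: "x \<in> unit_ball d \<Longrightarrow> L2_set x {..<d} \<le> 1"
  by (simp add: unit_ball_def)

lemma unit_sphere_subset_ball: "unit_sphere d \<subseteq> unit_ball d"
  by (auto simp: unit_sphere_def unit_ball_def)

lemma inner_prod_bounded:
  assumes "x \<in> unit_ball d" "v \<in> unit_sphere d"
  shows "\<bar>inner_prod d x v\<bar> \<le> 1"
  using inner_prod_Cauchy_Schwarz[of d x v] unit_sphereD[OF assms(2)] unit_ballD[OF assms(1)]
  by simp

text \<open>
  Expanded by the addition theorem, the right-hand side is \<open>p q + sqrt (1 - p\<^sup>2) sqrt (1 - q\<^sup>2)\<close> with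
  \<open>p = \<langle>x, v\<rangle>\<close> and \<open>q = \<langle>v, w\<rangle>\<close>. So the claim is the Cauchy-Schwarz inequality for the components of
  \<open>x\<close> and \<open>w\<close> orthogonal to \<open>v\<close>, whose inner product is \<open>\<langle>x, w\<rangle> - p q\<close>.
\<close>

lemma inner_prod_le_cos_diff:
  assumes x: "x \<in> unit_ball d" and v: "v \<in> unit_sphere d" and w: "w \<in> unit_sphere d"
  shows "inner_prod d x w \<le> cos (arccos (inner_prod d x v) - arccos (inner_prod d v w))"
proof -
  let ?p = "inner_prod d x v" and ?q = "inner_prod d v w"
  have vv: "inner_prod d v v = 1" "inner_prod d w w = 1"
    using unit_sphereD v w by (simp_all add: inner_prod_self)
  have "L2_set x {..<d} ^ 2 \<le> 1 ^ 2"
    using unit_ballD[OF x] by (intro power_mono) auto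
  then have xx: "inner_prod d x x \<le> 1" by (simp add: inner_prod_self)
  have p: "\<bar>?p\<bar> \<le> 1" and q: "\<bar>?q\<bar> \<le> 1"
    using inner_prod_bounded x v w unit_sphere_subset_ball by blast+
  define a where "a = (\<lambda>i. x i - ?p * v i)"
  define b where "b = (\<lambda>i. w i - ?q * v i)"
  have exp: "inner_prod d (\<lambda>i. f i - s * v i) (\<lambda>i. g i - t * v i)
     = inner_prod d f g - t * inner_prod d f v - s * inner_prod d v g + s * t" for f g s t
    using vv(1) unfolding inner_prod_def
    by (simp add: algebra_simps sum.distrib sum_subtractf sum_distrib_left[symmetric])
  have ab: "inner_prod d a b = inner_prod d x w - ?p * ?q"
    unfolding a_def b_def exp by (simp add: algebra_simps)
  have aa: "inner_prod d a a \<le> 1 - ?p\<^sup>2"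
    unfolding a_def exp using xx by (simp add: algebra_simps power2_eq_square inner_prod_commute[of d v x])
  have bb: "inner_prod d b b = 1 - ?q\<^sup>2"
    unfolding b_def exp using vv by (simp add: algebra_simps power2_eq_square inner_prod_commute[of d w v])
  have "inner_prod d a b \<le> L2_set a {..<d} * L2_set b {..<d}"
    using inner_prod_Cauchy_Schwarz[of d a b] by linarith
  also have "\<dots> \<le> sqrt (1 - ?p\<^sup>2) * sqrt (1 - ?q\<^sup>2)"
    using aa bb p by (intro mult_mono real_le_rsqrt) (auto simp: inner_prod_self abs_square_le_1)
  finally have "inner_prod d x w \<le> ?p * ?q + sqrt (1 - ?p\<^sup>2) * sqrt (1 - ?q\<^sup>2)"
    using ab by simp
  also have "\<dots> = cos (arccos ?p - arccos ?q)"
    using p q by (simp add: cos_diff sin_arccos_abs abs_le_iff cos_arccos)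
  finally show ?thesis .
qed

lemma sphere_dist_commute: "sphere_dist s d v w = sphere_dist s d w v"
  by (cases s) (simp_all add: L2_set_def power2_commute inner_prod_commute)

lemma sphere_dist_nonneg:
  assumes "v \<in> unit_sphere d" "w \<in> unit_sphere d"
  shows "0 \<le> sphere_dist s d v w"
  using inner_prod_bounded[of v d w] assms unit_sphere_subset_ball[of d]
  by (cases s) (auto intro!: arccos_lbound simp: abs_le_iff)

lemma sphere_dist_self: "v \<in> unit_sphere d \<Longrightarrow> sphere_dist s d v v = 0"
  by (cases s) (simp_all add: inner_prod_self unit_sphereD L2_set_0')

text \<open>
  For angles, apply \<open>inner_prod_le_cos_diff\<close> to \<open>u\<close> and \<open>v\<close> with \<open>w\<close> as the reference direction, and
  take the arccosine of both sides.
\<close>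

lemma sphere_dist_triangle:
  assumes u: "u \<in> unit_sphere d" and v: "v \<in> unit_sphere d" and w: "w \<in> unit_sphere d"
  shows "sphere_dist s d u w \<le> sphere_dist s d u v + sphere_dist s d v w"
proof (cases s)
  case Height
  then show ?thesis
    using L2_set_triangle_ineq[of "\<lambda>i. u i - v i" "\<lambda>i. v i - w i" "{..<d}"] by simp
next
  case Angle
  have bd: "\<bar>inner_prod d x y\<bar> \<le> 1" if "x \<in> unit_sphere d" "y \<in> unit_sphere d" for x y
    using inner_prod_bounded that unit_sphere_subset_ball by blast
  have range: "0 \<le> arccos (inner_prod d x y)" "arccos (inner_prod d x y) \<le> pi"
    if "x \<in> unit_sphere d" "y \<in> unit_sphere d" for x y
    using bd[OF that] by (auto intro: arccos_lbound arccos_ubound)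
  let ?a = "arccos (inner_prod d u w)" and ?b = "arccos (inner_prod d w v)"
  show ?thesis
  proof (cases "?a \<le> ?b")
    case True
    then show ?thesis
      using Angle range[OF u v] by (simp add: inner_prod_commute[of d v w])
  next
    case False
    have "inner_prod d u v \<le> cos (?a - ?b)"
      using inner_prod_le_cos_diff[OF _ w v] u unit_sphere_subset_ball by blast
    then have "arccos (cos (?a - ?b)) \<le> arccos (inner_prod d u v)"
      using bd[OF u v] by (intro arccos_le_arccos) auto
    moreover have "arccos (cos (?a - ?b)) = ?a - ?b"
      using False range[OF u w] range[OF w v] by (intro arccos_cos) auto
    ultimately show ?thesis
      using Angle by (simp add: inner_prod_commute[of d v w])
  qed
qed

text \<open>
  For heights, passing from \<open>v\<close> to \<open>w\<close> changes the height of a point of the unit ball by at most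
  \<open>\<parallel>v - w\<parallel>\<close>. For angles, the generalized angle \<open>arccos \<langle>x, v\<rangle>\<close> is at least \<open>- \<alpha>\<close> on the sublevel
  set and drops by at most \<open>arccos \<langle>v, w\<rangle>\<close>, which leaves at least \<open>- \<beta>\<close>. The objects with
  \<open>\<beta> = sup X\<close> impose no condition, because the threshold is then \<open>1\<close> and the set is contained in
  the unit ball.
\<close>

lemma sublevel_subset:
  assumes M: "M \<subseteq> unit_ball d" and v: "v \<in> unit_sphere d" and w: "w \<in> unit_sphere d"
    and \<alpha>: "\<alpha> \<in> param_set s" and \<beta>: "\<beta> \<in> param_set s"
    and le: "spacetime_le s d (v, \<alpha>) (w, \<beta>)"
  shows "{x \<in> M. inner_prod d x v \<le> threshold s \<alpha>} \<subseteq> {x \<in> M. inner_prod d x w \<le> threshold s \<beta>}"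
proof (rule Collect_mono, rule impI, erule conjE, rule conjI)
  fix x assume x: "x \<in> M" and h: "inner_prod d x v \<le> threshold s \<alpha>"
  then have xb: "x \<in> unit_ball d" using M by auto
  show "inner_prod d x w \<le> threshold s \<beta>"
  proof (cases "\<beta> = Sup (param_set s)")
    case True
    then have "threshold s \<beta> = 1" by (cases s) simp_all
    then show ?thesis using inner_prod_bounded[OF xb w] by simp
  next
    case False
    then have le: "\<alpha> + sphere_dist s d v w \<le> \<beta>" using le by simp
    show ?thesis
    proof (cases s)
      case Height
      have "inner_prod d x w = inner_prod d x v + inner_prod d x (\<lambda>i. w i - v i)"
        by (simp add: inner_prod_def algebra_simps sum_subtractf)
      also have "inner_prod d x (\<lambda>i. w i - v i) \<le> L2_set x {..<d} * sphere_dist Height d w v"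
        using inner_prod_Cauchy_Schwarz[of d x "\<lambda>i. w i - v i"] by simp
      also have "\<dots> \<le> 1 * sphere_dist Height d w v"
        using unit_ballD[OF xb] by (intro mult_right_mono) auto
      finally show ?thesis
        using Height h le by (simp add: sphere_dist_commute[of _ d w v] del: sphere_dist.simps)
    next
      case Angle
      let ?b = "arccos (inner_prod d x v)" and ?c = "arccos (inner_prod d v w)"
      have bd: "\<bar>inner_prod d x v\<bar> \<le> 1" "\<bar>inner_prod d v w\<bar> \<le> 1"
        using inner_prod_bounded xb v w unit_sphere_subset_ball by blast+
      have "arccos (cos (- \<alpha>)) \<le> ?b"
        using bd h Angle by (intro arccos_le_arccos) auto
      moreover have "arccos (cos (- \<alpha>)) = - \<alpha>"
        using \<alpha> Angle by (intro arccos_cos) auto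
      moreover have "?b \<le> pi" "0 \<le> ?c" using bd by (auto intro: arccos_lbound arccos_ubound)
      ultimately have "cos (?b - ?c) \<le> cos (- \<beta>)"
        using \<beta> Angle le by (intro cos_monotone_0_pi_le) auto
      then show ?thesis
        using inner_prod_le_cos_diff[OF xb v w] Angle by simp
    qed
  qed
qed

lemma param_set_bounds:
  "x \<in> param_set s \<Longrightarrow> x \<le> Sup (param_set s)" "Sup (param_set s) \<in> param_set s"
  by (cases s; simp)+

lemma spacetime_le_trans:
  assumes "u \<in> unit_sphere d" "v \<in> unit_sphere d" "w \<in> unit_sphere d" "\<gamma> \<in> param_set s"
    and "spacetime_le s d (u, \<alpha>) (v, \<beta>)" "spacetime_le s d (v, \<beta>) (w, \<gamma>)"
  shows "spacetime_le s d (u, \<alpha>) (w, \<gamma>)"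
  using sphere_dist_triangle[OF assms(1-3), of s] sphere_dist_nonneg[OF assms(2,3), of s]
    param_set_bounds(1)[OF assms(4)] assms(5,6) by auto

text \<open>
  The point \<open>x + \<epsilon>\<^sub>A\<close> may leave the interval \<open>X\<close>. Then \<open>t\<close> is chosen near \<open>sup X\<close> instead, which
  forces \<open>t = sup X\<close>. As \<open>x + 2 \<epsilon>\<^sub>A + \<epsilon>\<^sub>T\<close> is then cut off to \<open>sup X\<close> too, both relations hold because
  the objects at \<open>sup X\<close> are above all others.
\<close>

lemma spacetime_net_between:
  assumes A: "sphere_net s d \<epsilon>A A" and T: "interval_net (param_set s) \<epsilon>T T"
    and w: "w \<in> unit_sphere d" and v: "v \<in> A" "sphere_dist s d v w \<le> \<epsilon>A"
    and x: "x \<in> param_set s"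
  shows "\<exists>t\<in>T. spacetime_le s d (w, x) (v, t) \<and>
    spacetime_le s d (v, t) (w, shift (param_set s) (2 * \<epsilon>A + \<epsilon>T) x)"
proof -
  let ?m = "Sup (param_set s)" and ?\<tau> = "shift (param_set s) (2 * \<epsilon>A + \<epsilon>T)"
  have vS: "v \<in> unit_sphere d" using A v by (auto simp: sphere_net_def)
  have dist: "0 \<le> sphere_dist s d v w" "sphere_dist s d w v \<le> \<epsilon>A"
    using sphere_dist_nonneg[OF vS w] v sphere_dist_commute[of s d v w] by metis+
  define y where "y = min (x + \<epsilon>A) ?m"
  have y: "y \<in> param_set s"
    using x order_trans[OF dist(1) v(2)] by (cases s) (auto simp: y_def)
  obtain t where t: "t \<in> T" "y \<le> t" "t \<le> y + \<epsilon>T" using T y by (auto simp: interval_net_def)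
  have "t \<le> ?m" using T t(1) param_set_bounds(1) by (auto simp: interval_net_def)
  then have "spacetime_le s d (w, x) (v, t)"
    using t(2) dist(2) by (auto simp: y_def)
  moreover have "spacetime_le s d (v, t) (w, ?\<tau> x)"
    using t(3) v(2) by (auto simp: y_def shift_def)
  ultimately show ?thesis using t(1) by blast
qed


lemma nets_nonneg:
  assumes "sphere_net s d \<epsilon>A A" and "interval_net (param_set s) \<epsilon>T T" and "w \<in> unit_sphere d"
  shows "0 \<le> \<epsilon>A" and "0 \<le> \<epsilon>T"
proof -
  obtain v where "v \<in> A" "sphere_dist s d v w \<le> \<epsilon>A" "v \<in> unit_sphere d"
    using assms(1,3) unfolding sphere_net_def by blast
  then show "0 \<le> \<epsilon>A" using sphere_dist_nonneg[OF _ assms(3), of v] order_trans by blast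
  show "0 \<le> \<epsilon>T"
    using assms(2) param_set_bounds(2)[of s] by (force simp: interval_net_def)
qed

section \<open>The persistent homology transform\<close>

lemma PHT_spacetime_diagram:
  assumes M: "M \<subseteq> unit_ball d"
  shows "transitive_diagram (unit_sphere d \<times> param_set s) (spacetime_le s d)
     (PHT_spacetime TYPE('k::field) s d n M)"
proof (rule transitive_diagram.intro)
  fix p q r assume "p \<in> unit_sphere d \<times> param_set s" "q \<in> unit_sphere d \<times> param_set s"
    "r \<in> unit_sphere d \<times> param_set s" "spacetime_le s d p q" "spacetime_le s d q r"
  then show "spacetime_le s d p r"
    by (cases p; cases q; cases r) (auto simp del: spacetime_le.simps intro: spacetime_le_trans)
next
  fix p assume "p \<in> unit_sphere d \<times> param_set s"
  show "module scalars (ob (PHT_spacetime TYPE('k) s d n M) p)"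
    by (cases p) (simp add: PHT_spacetime_def PHT_def homology_module)
next
  fix p q
  assume *: "p \<in> unit_sphere d \<times> param_set s" "q \<in> unit_sphere d \<times> param_set s" "spacetime_le s d p q"
  obtain v \<alpha> w \<beta> where pq: "p = (v, \<alpha>)" "q = (w, \<beta>)" by (metis prod.exhaust)
  show "ar (PHT_spacetime TYPE('k) s d n M) p q
      \<in> linear_maps (ob (PHT_spacetime TYPE('k) s d n M) p) (ob (PHT_spacetime TYPE('k) s d n M) q)"
    using homology_incl_linear[OF sublevel_subset[OF M, of v w \<alpha> s \<beta>]] *
    by (simp add: pq PHT_spacetime_def PHT_def sublevel_def del: spacetime_le.simps)
next
  fix p q r :: spacetime and C
  assume *: "p \<in> unit_sphere d \<times> param_set s" "q \<in> unit_sphere d \<times> param_set s"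
    "r \<in> unit_sphere d \<times> param_set s" "spacetime_le s d p q" "spacetime_le s d q r"
    and C: "C \<in> carrier (ob (PHT_spacetime TYPE('k) s d n M) p)"
  obtain u \<alpha> v \<beta> w \<gamma> where pqr: "p = (u, \<alpha>)" "q = (v, \<beta>)" "r = (w, \<gamma>)"
    by (metis prod.exhaust)
  show "ar (PHT_spacetime TYPE('k) s d n M) q r (ar (PHT_spacetime TYPE('k) s d n M) p q C)
      = ar (PHT_spacetime TYPE('k) s d n M) p r C"
    using homology_incl_comp[OF sublevel_subset[OF M, of u v \<alpha> s \<beta>] sublevel_subset[OF M, of v w \<beta> s \<gamma>],
        of C n "Euclidean_space d"] * C
    by (simp add: pqr PHT_spacetime_def PHT_def sublevel_def del: spacetime_le.simps)
qed

text \<open>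
  The direction \<open>v\<close> is fixed before the parameters \<open>t x\<close> are chosen. So any two of the intermediate
  objects \<open>(v, t x)\<close> are comparable, although nothing is known about monotonicity of \<open>t\<close>.
\<close>

lemma PHT_factoring_slice:
  assumes M: "M \<subseteq> unit_ball d" and A: "sphere_net s d \<epsilon>A A"
    and T: "interval_net (param_set s) \<epsilon>T T" and w: "w \<in> unit_sphere d"
  shows "\<exists>\<sigma>. factoring_slice (unit_sphere d \<times> param_set s) (spacetime_le s d)
     (PHT_spacetime TYPE('k::field) s d n M) (A \<times> T) w (param_set s) (2 * \<epsilon>A + \<epsilon>T) \<sigma>"
proof -
  let ?\<tau> = "shift (param_set s) (2 * \<epsilon>A + \<epsilon>T)"
  obtain v where v: "v \<in> A" "sphere_dist s d v w \<le> \<epsilon>A" "v \<in> unit_sphere d"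
    using A w unfolding sphere_net_def by blast
  have "\<forall>x\<in>param_set s. \<exists>t\<in>T. spacetime_le s d (w, x) (v, t) \<and> spacetime_le s d (v, t) (w, ?\<tau> x)"
    using spacetime_net_between[OF A T w v(1,2)] by blast
  then obtain t where t: "\<And>x. x \<in> param_set s \<Longrightarrow> t x \<in> T"
    "\<And>x. x \<in> param_set s \<Longrightarrow> spacetime_le s d (w, x) (v, t x)"
    "\<And>x. x \<in> param_set s \<Longrightarrow> spacetime_le s d (v, t x) (w, ?\<tau> x)"
    by metis
  have e: "0 \<le> 2 * \<epsilon>A + \<epsilon>T" using nets_nonneg[OF A T w] by simp
  interpret transitive_diagram "unit_sphere d \<times> param_set s" "spacetime_le s d"
    "PHT_spacetime TYPE('k) s d n M"
    by (rule PHT_spacetime_diagram[OF M])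
  have "factoring_slice (unit_sphere d \<times> param_set s) (spacetime_le s d)
     (PHT_spacetime TYPE('k) s d n M) (A \<times> T) w (param_set s) (2 * \<epsilon>A + \<epsilon>T) (\<lambda>x. (v, t x))"
  proof
    show "A \<times> T \<subseteq> unit_sphere d \<times> param_set s"
      using A T by (auto simp: sphere_net_def interval_net_def)
    show "?\<tau> x \<in> param_set s" "x \<le> ?\<tau> x" "?\<tau> (?\<tau> x) = shift (param_set s) (2 * (2 * \<epsilon>A + \<epsilon>T)) x"
      if "x \<in> param_set s" for x
      using that e by (cases s; simp add: shift_def)+
    show "spacetime_le s d (v, t x) (v, t y) \<or> spacetime_le s d (v, t y) (v, t x)" for x y
      using sphere_dist_self[OF v(3), of s] linear[of "t x" "t y"] by auto
    show "spacetime_le s d (w, x) (w, y)" if "x \<le> y" for x y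
      using that sphere_dist_self[OF w, of s] by simp
  qed (use w v t in \<open>auto simp del: spacetime_le.simps\<close>)
  then show ?thesis by blast
qed

text \<open>
  For \<open>d = 0\<close> the sphere is empty and the supremum is \<open>0\<close>, whatever the sign of \<open>e\<close>.
\<close>

lemma PHT_dist_le:
  assumes "0 \<le> e \<or> unit_sphere d = {}"
    and "\<And>w. w \<in> unit_sphere d \<Longrightarrow> interleaved (param_set s) e (F w) (F' w)"
  shows "PHT_dist s d F F' \<le> ennreal e"
  unfolding PHT_dist_def interleaving_dist_def
  using assms by (intro SUP_least INF_lower) auto

theorem theorem4p12:
  fixes Om :: "nat \<Rightarrow> (nat \<Rightarrow> real) set set"
    and d n :: nat
    and s :: scale
    and M A :: "(nat \<Rightarrow> real) set"
    and T :: "real set"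
    and \<epsilon>A \<epsilon>T :: real
  assumes "o_minimal Om"
    and "constructible Om d M"
    and "M \<subseteq> unit_ball d"
    and "sphere_net s d \<epsilon>A A"
    and "interval_net (param_set s) \<epsilon>T T"
  shows "PHT_dist s d (PHT TYPE('k::field) s d n M) (PHT_left TYPE('k) s d n M A T)
           \<le> ennreal (2 * \<epsilon>A + \<epsilon>T) \<and>
         PHT_dist s d (PHT TYPE('k) s d n M) (PHT_right TYPE('k) s d n M A T)
           \<le> ennreal (2 * \<epsilon>A + \<epsilon>T) \<and>
         PHT_dist s d (PHT TYPE('k) s d n M) (PHT_center TYPE('k) s d n M A T)
           \<le> ennreal (2 * \<epsilon>A + \<epsilon>T)"
proof -
  note A = assms(4) and T = assms(5)
  have e: "0 \<le> 2 * \<epsilon>A + \<epsilon>T \<or> unit_sphere d = {}"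
    using nets_nonneg[OF A T] by fastforce
  have PHT: "PHT TYPE('k) s d n M w = slice (PHT_spacetime TYPE('k) s d n M) w" for w
    by (simp add: PHT_def PHT_spacetime_def slice_def)
  show ?thesis
  proof (intro conjI PHT_dist_le[OF e])
    fix w assume w: "w \<in> unit_sphere d"
    obtain \<sigma> where "factoring_slice (unit_sphere d \<times> param_set s) (spacetime_le s d)
        (PHT_spacetime TYPE('k) s d n M) (A \<times> T) w (param_set s) (2 * \<epsilon>A + \<epsilon>T) \<sigma>"
      using PHT_factoring_slice[OF assms(3) A T w] by blast
    then interpret factoring_slice "unit_sphere d \<times> param_set s" "spacetime_le s d"
      "PHT_spacetime TYPE('k) s d n M" "A \<times> T" w "param_set s" "2 * \<epsilon>A + \<epsilon>T" \<sigma> .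
    show "interleaved (param_set s) (2 * \<epsilon>A + \<epsilon>T)
        (PHT TYPE('k) s d n M w) (PHT_left TYPE('k) s d n M A T w)"
      unfolding PHT PHT_left_def by (rule interleaved_left)
    show "interleaved (param_set s) (2 * \<epsilon>A + \<epsilon>T)
        (PHT TYPE('k) s d n M w) (PHT_right TYPE('k) s d n M A T w)"
      unfolding PHT PHT_right_def by (rule interleaved_right)
    show "interleaved (param_set s) (2 * \<epsilon>A + \<epsilon>T)
        (PHT TYPE('k) s d n M w) (PHT_center TYPE('k) s d n M A T w)"
      unfolding PHT PHT_center_def by (rule interleaved_center)
  qed
qed

end
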